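(* Let $A,B\in\mathscr L(E;F)$ be positive operators on the weak-* sequentially complete anti-dual pair $\langle F,E\rangle$. Then $$\lim_{n\to\infty}\langle((nA):B)x,y\rangle=\langle J_B(I-P)J_B^*x,y\rangle,\qquad x,y\in E.$$ In other words, the operator $[A]B$ is identical with the $A$-absolutely continuous part $B_a$ of $B$.
   Context: An anti-dual pair $\langle F,E\rangle$ consists of complex vector spaces $E,F$ and a map $\langle\cdot,\cdot\rangle:F\times E\to\mathbb C$, linear in the first and conjugate linear in the second variable, that separates the points of $E$ and of $F$. $\sigma(F,E)$ is the weak topology on $F$ induced by the functionals $\langle\cdot,x\rangle$ ($x\in E$), and $\sigma(E,F)$ is the weak topology on $E$ induced by the functionals $\langle f,\cdot\rangle$ ($f\in F$). The pair is weak-* sequentially complete if every Cauchy sequence of $(F,\sigma(F,E))$ converges. $\mathscr L(E;F)$ is the set of $\sigma(E,F)$-$\sigma(F,E)$ continuous linear operators $E\to F$. A linear operator $A:E\to F$ is positive if $\langle Ax,x\rangle\ge0$ for all $x\in E$ (such operators belong to $\mathscr L(E;F)$ automatically). Parallel sum: for positive $A,B$, $A:B\in\mathscr L(E;F)$ is the unique positive operator with $\langle(A:B)x,x\rangle=\inf\{\langle A(x-y),x-y\rangle+\langle By,y\rangle:y\in E\}$ for all $x\in E$. $[A]B\in\mathscr L(E;F)$ is the positive operator defined by $\langle[A]Bx,y\rangle:=\lim_{n\to\infty}\langle((nA):B)x,y\rangle$, $x,y\in E$. Auxiliary Hilbert spaces: for a positive $A$, $\mathcal H_A$ is the Hilbert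 completion of $\operatorname{ran}A$ under the (well-defined) inner product $(Ax\,|\,Ay)_A:=\langle Ax,y\rangle$. $J_A:\mathcal H_A\to F$ is the unique weakly continuous (weak topology of $\mathcal H_A$ to $\sigma(F,E)$) linear extension of the inclusion $\operatorname{ran}A\hookrightarrow F$; its adjoint $J_A^*:E\to\mathcal H_A$, determined by $\langle J_Ah,x\rangle=(h\,|\,J_A^*x)_A$, satisfies $J_A^*x=Ax$, and $A=J_AJ_A^*$. $\mathcal H_B$, $J_B$ are defined likewise. $P$ is the orthogonal projection of $\mathcal H_B$ onto the closed subspace $\mathcal M:=\{\xi\in\mathcal H_B:(0,\xi)\in\overline{\{(Ax,Bx):x\in E\}}\}$ (closure in $\mathcal H_A\times\mathcal H_B$). The $A$-absolutely continuous part of $B$ is $B_a:=J_B(I-P)J_B^*$. *)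

theory Defs
  imports "HOL-Analysis.Analysis"
begin

section \<open>Anti-dual pairs and their weak topologies\<close>

locale anti_dual_pair =
  E: vector_space scaleE + F: vector_space scaleF
  for scaleE :: "complex \<Rightarrow> 'e::ab_group_add \<Rightarrow> 'e"
    and scaleF :: "complex \<Rightarrow> 'f::ab_group_add \<Rightarrow> 'f" +
  fixes pair :: "'f \<Rightarrow> 'e \<Rightarrow> complex"
  assumes pair_add_left: "pair (f + g) x = pair f x + pair g x"
    and pair_scale_left: "pair (scaleF c f) x = c * pair f x"
    and pair_add_right: "pair f (x + y) = pair f x + pair f y"
    and pair_scale_right: "pair f (scaleE c x) = cnj c * pair f x"
    and separates_F: "f \<noteq> 0 \<Longrightarrow> \<exists>x. pair f x \<noteq> 0"
    and separates_E: "x \<noteq> 0 \<Longrightarrow> \<exists>f. pair f x \<noteq> 0"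

text \<open>The coarsest topology on \<open>S\<close> making all functions \<open>\<lambda>v. \<phi> v i\<close> with \<open>i \<in> I\<close> continuous.\<close>

definition weak_topology :: "'v set \<Rightarrow> 'i set \<Rightarrow> ('v \<Rightarrow> 'i \<Rightarrow> complex) \<Rightarrow> 'v topology"
  where "weak_topology S I \<phi> =
    pullback_topology S (\<lambda>v. restrict (\<phi> v) I) (product_topology (\<lambda>_. euclidean) I)"

abbreviation sigma_FE :: "('f \<Rightarrow> 'e \<Rightarrow> complex) \<Rightarrow> 'f topology"
  where "sigma_FE pair \<equiv> weak_topology UNIV UNIV pair"

abbreviation sigma_EF :: "('f \<Rightarrow> 'e \<Rightarrow> complex) \<Rightarrow> 'e topology"
  where "sigma_EF pair \<equiv> weak_topology UNIV UNIV (\<lambda>x f. pair f x)"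

text \<open>Cauchy sequences are those of the uniformity of the topological vector space \<open>(F, \<sigma>(F,E))\<close>.\<close>

definition weak_star_Cauchy :: "('f::ab_group_add \<Rightarrow> 'e \<Rightarrow> complex) \<Rightarrow> (nat \<Rightarrow> 'f) \<Rightarrow> bool"
  where "weak_star_Cauchy pair s \<longleftrightarrow>
    (\<forall>U. openin (sigma_FE pair) U \<and> 0 \<in> U \<longrightarrow> (\<exists>N. \<forall>m\<ge>N. \<forall>n\<ge>N. s m - s n \<in> U))"

definition weak_star_seq_complete :: "('f::ab_group_add \<Rightarrow> 'e \<Rightarrow> complex) \<Rightarrow> bool"
  where "weak_star_seq_complete pair \<longleftrightarrow>
    (\<forall>s. weak_star_Cauchy pair s \<longrightarrow> (\<exists>f. limitin (sigma_FE pair) s f sequentially))"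

section \<open>Weakly continuous and positive operators\<close>

definition weak_ops ::
  "(complex \<Rightarrow> 'e::ab_group_add \<Rightarrow> 'e) \<Rightarrow> (complex \<Rightarrow> 'f::ab_group_add \<Rightarrow> 'f)
    \<Rightarrow> ('f \<Rightarrow> 'e \<Rightarrow> complex) \<Rightarrow> ('e \<Rightarrow> 'f) set"
  where "weak_ops scaleE scaleF pair =
    {T. Vector_Spaces.linear scaleE scaleF T \<and> continuous_map (sigma_EF pair) (sigma_FE pair) T}"

definition positive_op ::
  "(complex \<Rightarrow> 'e::ab_group_add \<Rightarrow> 'e) \<Rightarrow> (complex \<Rightarrow> 'f::ab_group_add \<Rightarrow> 'f)
    \<Rightarrow> ('f \<Rightarrow> 'e \<Rightarrow> complex) \<Rightarrow> ('e \<Rightarrow> 'f) \<Rightarrow> bool"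
  where "positive_op scaleE scaleF pair T \<longleftrightarrow>
    Vector_Spaces.linear scaleE scaleF T \<and> (\<forall>x. pair (T x) x \<in> \<real>\<^sub>\<ge>\<^sub>0)"

definition parallel_sum ::
  "(complex \<Rightarrow> 'e::ab_group_add \<Rightarrow> 'e) \<Rightarrow> (complex \<Rightarrow> 'f::ab_group_add \<Rightarrow> 'f)
    \<Rightarrow> ('f \<Rightarrow> 'e \<Rightarrow> complex) \<Rightarrow> ('e \<Rightarrow> 'f) \<Rightarrow> ('e \<Rightarrow> 'f) \<Rightarrow> 'e \<Rightarrow> 'f"
  where "parallel_sum scaleE scaleF pair A B =
    (THE C. C \<in> weak_ops scaleE scaleF pair \<and> positive_op scaleE scaleF pair C \<and>
      (\<forall>x. pair (C x) x =
        complex_of_real (INF y. Re (pair (A (x - y)) (x - y)) + Re (pair (B y) y))))"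

definition op_multiple ::
  "(complex \<Rightarrow> 'f \<Rightarrow> 'f) \<Rightarrow> nat \<Rightarrow> ('e \<Rightarrow> 'f) \<Rightarrow> 'e \<Rightarrow> 'f"
  where "op_multiple scaleF n A = (\<lambda>x. scaleF (of_nat n) (A x))"

text \<open>The operator written \<open>[A]B\<close>.\<close>

definition parallel_limit ::
  "(complex \<Rightarrow> 'e::ab_group_add \<Rightarrow> 'e) \<Rightarrow> (complex \<Rightarrow> 'f::ab_group_add \<Rightarrow> 'f)
    \<Rightarrow> ('f \<Rightarrow> 'e \<Rightarrow> complex) \<Rightarrow> ('e \<Rightarrow> 'f) \<Rightarrow> ('e \<Rightarrow> 'f) \<Rightarrow> 'e \<Rightarrow> 'f"
  where "parallel_limit scaleE scaleF pair A B =
    (THE T. T \<in> weak_ops scaleE scaleF pair \<and> positive_op scaleE scaleF pair T \<and>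
      (\<forall>x y. (\<lambda>n. pair (parallel_sum scaleE scaleF pair (op_multiple scaleF n A) B x) y)
        \<longlonglongrightarrow> pair (T x) y))"

section \<open>Hilbert spaces and Hilbert completions\<close>

text \<open>A complex Hilbert space is carried by a linear subspace of an ambient complex vector space;
  the inner product is linear in its first argument and only matters on the carrier.\<close>

record 'h hilbert =
  hcarrier :: "'h set"
  hscale :: "complex \<Rightarrow> 'h \<Rightarrow> 'h"
  hinner :: "'h \<Rightarrow> 'h \<Rightarrow> complex"

text \<open>Set to 0 off the carrier, since \<^locale>\<open>Metric_space\<close> requires nonnegativity and
  symmetry of the distance everywhere.\<close>

definition hdist :: "'h::ab_group_add hilbert \<Rightarrow> 'h \<Rightarrow> 'h \<Rightarrow> real"
  where "hdist H x y = (if x \<in> hcarrier H \<and> y \<in> hcarrier H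
    then sqrt (Re (hinner H (x - y) (x - y))) else 0)"

abbreviation htopology :: "'h::ab_group_add hilbert \<Rightarrow> 'h topology"
  where "htopology H \<equiv> Metric_space.mtopology (hcarrier H) (hdist H)"

abbreviation hweak_topology :: "'h hilbert \<Rightarrow> 'h topology"
  where "hweak_topology H \<equiv> weak_topology (hcarrier H) (hcarrier H) (hinner H)"

locale hilbert_space = vector_space "hscale H" for H :: "'h::ab_group_add hilbert" +
  assumes subspace_hcarrier: "subspace (hcarrier H)"
    and hinner_add_left: "\<lbrakk>x \<in> hcarrier H; y \<in> hcarrier H; z \<in> hcarrier H\<rbrakk>
      \<Longrightarrow> hinner H (x + y) z = hinner H x z + hinner H y z"
    and hinner_scale_left: "\<lbrakk>x \<in> hcarrier H; y \<in> hcarrier H\<rbrakk>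
      \<Longrightarrow> hinner H (hscale H c x) y = c * hinner H x y"
    and hinner_commute: "\<lbrakk>x \<in> hcarrier H; y \<in> hcarrier H\<rbrakk>
      \<Longrightarrow> hinner H y x = cnj (hinner H x y)"
    and hinner_nonneg: "x \<in> hcarrier H \<Longrightarrow> hinner H x x \<in> \<real>\<^sub>\<ge>\<^sub>0"
    and hinner_definite: "\<lbrakk>x \<in> hcarrier H; hinner H x x = 0\<rbrakk> \<Longrightarrow> x = 0"
    and complete: "Metric_space.mcomplete (hcarrier H) (hdist H)"

definition linear_on ::
  "'v::plus set \<Rightarrow> (complex \<Rightarrow> 'v \<Rightarrow> 'v) \<Rightarrow> (complex \<Rightarrow> 'w::plus \<Rightarrow> 'w) \<Rightarrow> ('v \<Rightarrow> 'w) \<Rightarrow> bool"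
  where "linear_on V scaleV scaleW T \<longleftrightarrow>
    (\<forall>u\<in>V. \<forall>v\<in>V. T (u + v) = T u + T v) \<and> (\<forall>c. \<forall>v\<in>V. T (scaleV c v) = scaleW c (T v))"

text \<open>\<open>H\<close>, together with the embedding \<open>\<iota>\<close>, is a Hilbert completion of the linear subspace
  \<open>V\<close> with inner product \<open>ip\<close>.\<close>

definition hilbert_completion ::
  "'v::ab_group_add set \<Rightarrow> (complex \<Rightarrow> 'v \<Rightarrow> 'v) \<Rightarrow> ('v \<Rightarrow> 'v \<Rightarrow> complex)
    \<Rightarrow> 'h::ab_group_add hilbert \<Rightarrow> ('v \<Rightarrow> 'h) \<Rightarrow> bool"
  where "hilbert_completion V scaleV ip H \<iota> \<longleftrightarrow>
    hilbert_space H \<and> \<iota> \<in> V \<rightarrow> hcarrier H \<and> linear_on V scaleV (hscale H) \<iota> \<and>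
    (\<forall>u\<in>V. \<forall>v\<in>V. hinner H (\<iota> u) (\<iota> v) = ip u v) \<and>
    htopology H closure_of (\<iota> ` V) = hcarrier H"

definition orth_proj :: "'h::ab_group_add hilbert \<Rightarrow> 'h set \<Rightarrow> 'h \<Rightarrow> 'h"
  where "orth_proj H M h = (THE p. p \<in> M \<and> (\<forall>m\<in>M. hinner H (h - p) m = 0))"

section \<open>The auxiliary Hilbert space of a positive operator\<close>

text \<open>The inner product \<open>(Ax | Ay)\<^sub>A = \<langle>Ax, y\<rangle>\<close> on the range of \<open>A\<close>.\<close>

definition ran_inner :: "('f \<Rightarrow> 'e \<Rightarrow> complex) \<Rightarrow> ('e \<Rightarrow> 'f) \<Rightarrow> 'f \<Rightarrow> 'f \<Rightarrow> complex"
  where "ran_inner pair A u v = (THE c. \<exists>x y. u = A x \<and> v = A y \<and> c = pair (A x) y)"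

abbreviation aux_hilbert ::
  "(complex \<Rightarrow> 'f::ab_group_add \<Rightarrow> 'f) \<Rightarrow> ('f \<Rightarrow> 'e \<Rightarrow> complex) \<Rightarrow> ('e \<Rightarrow> 'f)
    \<Rightarrow> 'h::ab_group_add hilbert \<Rightarrow> ('f \<Rightarrow> 'h) \<Rightarrow> bool"
  where "aux_hilbert scaleF pair A H \<iota> \<equiv>
    hilbert_completion (range A) scaleF (ran_inner pair A) H \<iota>"

definition J_op ::
  "(complex \<Rightarrow> 'f::ab_group_add \<Rightarrow> 'f) \<Rightarrow> ('f \<Rightarrow> 'e \<Rightarrow> complex) \<Rightarrow> ('e \<Rightarrow> 'f)
    \<Rightarrow> 'h::ab_group_add hilbert \<Rightarrow> ('f \<Rightarrow> 'h) \<Rightarrow> 'h \<Rightarrow> 'f"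
  where "J_op scaleF pair A H \<iota> =
    (THE J. J \<in> extensional (hcarrier H) \<and> linear_on (hcarrier H) (hscale H) scaleF J \<and>
      continuous_map (hweak_topology H) (sigma_FE pair) J \<and> (\<forall>f\<in>range A. J (\<iota> f) = f))"

definition adjoint_op ::
  "('f \<Rightarrow> 'e \<Rightarrow> complex) \<Rightarrow> 'h hilbert \<Rightarrow> ('h \<Rightarrow> 'f) \<Rightarrow> 'e \<Rightarrow> 'h"
  where "adjoint_op pair H J x =
    (THE k. k \<in> hcarrier H \<and> (\<forall>h\<in>hcarrier H. pair (J h) x = hinner H h k))"

section \<open>The absolutely continuous part\<close>

definition multivalued_part ::
  "('e \<Rightarrow> 'f) \<Rightarrow> ('e \<Rightarrow> 'f) \<Rightarrow> 'h::ab_group_add hilbert \<Rightarrow> ('f \<Rightarrow> 'h)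
    \<Rightarrow> 'k::ab_group_add hilbert \<Rightarrow> ('f \<Rightarrow> 'k) \<Rightarrow> 'k set"
  where "multivalued_part A B HA \<iota>A HB \<iota>B =
    {\<xi> \<in> hcarrier HB. (0, \<xi>) \<in> prod_topology (htopology HA) (htopology HB) closure_of
      range (\<lambda>x. (\<iota>A (A x), \<iota>B (B x)))}"

definition abs_cont_part ::
  "(complex \<Rightarrow> 'f::ab_group_add \<Rightarrow> 'f) \<Rightarrow> ('f \<Rightarrow> 'e \<Rightarrow> complex)
    \<Rightarrow> ('e \<Rightarrow> 'f) \<Rightarrow> 'h::ab_group_add hilbert \<Rightarrow> ('f \<Rightarrow> 'h)
    \<Rightarrow> ('e \<Rightarrow> 'f) \<Rightarrow> 'k::ab_group_add hilbert \<Rightarrow> ('f \<Rightarrow> 'k) \<Rightarrow> 'e \<Rightarrow> 'f"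
  where "abs_cont_part scaleF pair A HA \<iota>A B HB \<iota>B x =
    (let J = J_op scaleF pair B HB \<iota>B;
         h = adjoint_op pair HB J x
     in J (h - orth_proj HB (multivalued_part A B HA \<iota>A HB \<iota>B) h))"

section \<open>Existence of the auxiliary Hilbert space\<close>

text \<open>The completion is realised inside \<open>F\<close> by the weak limits of the sequences \<open>A (s n)\<close> that are
  Cauchy in \<open>ran A\<close>; so \<^const>\<open>hilbert_completion\<close> is satisfiable for \<open>ran A\<close> on every
  weak-* sequentially complete pair.\<close>

lemma limitin_sigma_FE:
  fixes pair :: "'f \<Rightarrow> 'e \<Rightarrow> complex"
  shows "limitin (sigma_FE pair) s f F \<longleftrightarrow> (\<forall>x. ((\<lambda>n. pair (s n) x) \<longlongrightarrow> pair f x) F)"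
proof -
  let ?P = "product_topology (\<lambda>_. euclidean) UNIV :: ('e \<Rightarrow> complex) topology"
  have op: "openin (sigma_FE pair) U \<longleftrightarrow> (\<exists>V. openin ?P V \<and> U = pair -` V)" for U
    unfolding weak_topology_def openin_pullback_topology by (simp add: restrict_UNIV)
  have top: "topspace (sigma_FE pair) = UNIV"
    unfolding weak_topology_def topspace_pullback_topology by (simp add: restrict_UNIV)
  have "limitin (sigma_FE pair) s f F \<longleftrightarrow> limitin ?P (\<lambda>n. pair (s n)) (pair f) F"
  proof
    assume L: "limitin (sigma_FE pair) s f F"
    show "limitin ?P (\<lambda>n. pair (s n)) (pair f) F"
      unfolding limitin_def
    proof (intro conjI strip)
      fix V assume V: "openin ?P V \<and> pair f \<in> V"
      then have "openin (sigma_FE pair) (pair -` V)" unfolding op by blast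
      with L V have "\<forall>\<^sub>F n in F. s n \<in> pair -` V" unfolding limitin_def by blast
      then show "\<forall>\<^sub>F n in F. pair (s n) \<in> V" by simp
    qed simp
  next
    assume L: "limitin ?P (\<lambda>n. pair (s n)) (pair f) F"
    show "limitin (sigma_FE pair) s f F"
      unfolding limitin_def
    proof (intro conjI strip)
      fix U assume U: "openin (sigma_FE pair) U \<and> f \<in> U"
      then obtain V where V: "openin ?P V" "U = pair -` V" unfolding op by blast
      with L U have "\<forall>\<^sub>F n in F. pair (s n) \<in> V" unfolding limitin_def by blast
      then show "\<forall>\<^sub>F n in F. s n \<in> U" using V by simp
    qed (simp add: top)
  qed
  also have "\<dots> \<longleftrightarrow> (\<forall>x. ((\<lambda>n. pair (s n) x) \<longlongrightarrow> pair f x) F)"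
    unfolding limitin_componentwise by simp
  finally show ?thesis .
qed

lemma (in anti_dual_pair) pair_zero_left [simp]: "pair 0 x = 0"
  using pair_add_left[of 0 0 x] by simp
lemma (in anti_dual_pair) pair_zero_right [simp]: "pair f 0 = 0"
  using pair_add_right[of f 0 0] by simp
lemma (in anti_dual_pair) pair_diff_left: "pair (f - g) x = pair f x - pair g x"
  using pair_add_left[of "f - g" g x] by simp
lemma (in anti_dual_pair) pair_diff_right: "pair f (x - y) = pair f x - pair f y"
  using pair_add_right[of f "x - y" y] by simp
lemma (in anti_dual_pair) F_eqI: "(\<And>x. pair f x = pair g x) \<Longrightarrow> f = g"
  using separates_F[of "f - g"] by (auto simp: pair_diff_left)

locale positive_operator = anti_dual_pair +
  fixes A
  assumes seq_complete: "weak_star_seq_complete pair"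
    and positive: "positive_op scaleE scaleF pair A"
begin

lemma A_linear: "Vector_Spaces.linear scaleE scaleF A"
  using positive by (simp add: positive_op_def)

lemma A_add: "A (x + y) = A x + A y" and A_scale: "A (scaleE c x) = scaleF c (A x)"
  using A_linear by (auto simp: Vector_Spaces.linear_iff)

lemma A_0 [simp]: "A 0 = 0" and A_diff: "A (x - y) = A x - A y"
  using A_add[of 0 0] A_add[of "x - y" y] by auto

definition "q x y = pair (A x) y"

lemma q_simps: "q (x + y) z = q x z + q y z" "q x (y + z) = q x y + q x z"
  "q (x - y) z = q x z - q y z" "q x (y - z) = q x y - q x z"
  "q (scaleE c x) y = c * q x y" "q x (scaleE c y) = cnj c * q x y"
  "q 0 x = 0" "q x 0 = 0"
  by (auto simp: q_def A_add A_diff A_scale pair_add_left pair_diff_left pair_scale_left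
      pair_add_right pair_diff_right pair_scale_right)

lemma q_real: "Im (q x x) = 0" and q_nonneg: "0 \<le> Re (q x x)"
  using positive complex_nonneg_Reals_iff by (auto simp: positive_op_def q_def)

lemma q_herm: "q y x = cnj (q x y)"
  using q_real[of "x + y"] q_real[of "x + scaleE \<i> y"] q_real[of x] q_real[of y]
  by (auto simp: q_simps complex_eq_iff)

definition "nrm x = sqrt (Re (q x x))"

lemma nrm_nonneg [simp]: "0 \<le> nrm x"
  by (simp add: nrm_def q_nonneg)

lemma q_self: "q x x = of_real ((nrm x)\<^sup>2)"
  by (simp add: nrm_def q_nonneg complex_eq_iff q_real)

lemma nrm_minus: "nrm (x - y) = nrm (y - x)"
  by (simp add: nrm_def q_simps algebra_simps)

lemma q_le: "cmod (q x y) \<le> nrm x * nrm y"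
proof (cases "nrm x = 0 \<and> nrm y = 0")
  case True
  have "Re (q (x - scaleE (q x y) y) (x - scaleE (q x y) y)) \<ge> 0"
    by (rule q_nonneg)
  moreover have "q (x - scaleE (q x y) y) (x - scaleE (q x y) y)
      = q x x + q x y * cnj (q x y) * q y y - q x y * cnj (q x y) - q x y * cnj (q x y)"
    using q_herm[of x y] by (simp add: q_simps algebra_simps)
  moreover have "q x x = 0" "q y y = 0" using True by (auto simp: q_self)
  ultimately have "0 \<le> - (2 * (cmod (q x y))\<^sup>2)"
    by (simp add: complex_mult_cnj cmod_power2)
  then have "cmod (q x y) = 0" by simp
  then show ?thesis by simp
next
  case False
  have *: "(cmod (q x y))\<^sup>2 \<le> (nrm x)\<^sup>2 * (nrm y)\<^sup>2" if "nrm y \<noteq> 0" for x y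
  proof -
    define c where "c = q x y / q y y"
    have qy: "q y y \<noteq> 0" using that by (simp add: q_self)
    have cy: "cnj (q y y) = q y y" by (simp add: q_self)
    have "0 \<le> Re (q (x - scaleE c y) (x - scaleE c y))"
      by (rule q_nonneg)
    also have "q (x - scaleE c y) (x - scaleE c y)
        = q x x + c * cnj c * q y y - c * q y x - cnj c * q x y"
      by (simp add: q_simps algebra_simps)
    also have "\<dots> = q x x - q x y * cnj (q x y) / q y y"
      using qy cy q_herm[of x y] by (simp add: c_def field_simps)
    also have "\<dots> = of_real ((nrm x)\<^sup>2 - (cmod (q x y))\<^sup>2 / (nrm y)\<^sup>2)"
      by (simp add: q_self complex_mult_cnj cmod_power2)
    finally have "(cmod (q x y))\<^sup>2 / (nrm y)\<^sup>2 \<le> (nrm x)\<^sup>2" by simp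
    then show ?thesis using that by (simp add: field_simps)
  qed
  have "(cmod (q x y))\<^sup>2 \<le> (nrm x)\<^sup>2 * (nrm y)\<^sup>2"
  proof (cases "nrm y = 0")
    case True
    then have "(cmod (q y x))\<^sup>2 \<le> (nrm y)\<^sup>2 * (nrm x)\<^sup>2" using * False by blast
    then show ?thesis using q_herm[of y x] by (simp add: mult.commute)
  qed (rule *)
  then have "(cmod (q x y))\<^sup>2 \<le> (nrm x * nrm y)\<^sup>2" by (simp add: power_mult_distrib)
  then show ?thesis by (rule power2_le_imp_le) simp
qed

lemma nrm_triangle: "nrm (x + y) \<le> nrm x + nrm y"
proof (rule power2_le_imp_le)
  have "(nrm (x + y))\<^sup>2 = Re (q (x + y) (x + y))"
    by (simp only: q_self Re_complex_of_real)
  also have "\<dots> = Re (q x x) + Re (q y y) + Re (q x y) + Re (q y x)"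
    by (simp add: q_simps)
  also have "\<dots> = (nrm x)\<^sup>2 + (nrm y)\<^sup>2 + 2 * Re (q x y)"
    using q_herm[of y x] by (simp add: q_self)
  also have "\<dots> \<le> (nrm x + nrm y)\<^sup>2"
    using q_le[of x y] complex_Re_le_cmod[of "q x y"] by (simp add: power2_sum)
  finally show "(nrm (x + y))\<^sup>2 \<le> (nrm x + nrm y)\<^sup>2" .
qed simp

definition "approx s f \<longleftrightarrow>
  (\<forall>e>0. \<exists>N. \<forall>m\<ge>N. \<forall>n\<ge>N. nrm (s m - s n) < e) \<and> (\<forall>x. (\<lambda>n. q (s n) x) \<longlonglongrightarrow> pair f x)"

lemma approx_exists:
  assumes C: "\<And>e. e > 0 \<Longrightarrow> \<exists>N. \<forall>m\<ge>N. \<forall>n\<ge>N. nrm (s m - s n) < e"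
  shows "\<exists>f. approx s f"
proof -
  have "weak_star_Cauchy pair (\<lambda>n. A (s n))"
    unfolding weak_star_Cauchy_def
  proof (intro strip, rule ccontr)
    fix U assume U: "openin (sigma_FE pair) U \<and> 0 \<in> U"
      and "\<nexists>N. \<forall>m\<ge>N. \<forall>n\<ge>N. A (s m) - A (s n) \<in> U"
    then have "\<forall>N. \<exists>m n. m \<ge> N \<and> n \<ge> N \<and> A (s m) - A (s n) \<notin> U" by meson
    then obtain m n where mn: "\<And>N. m N \<ge> N" "\<And>N. n N \<ge> N" "\<And>N. A (s (m N)) - A (s (n N)) \<notin> U"
      by metis
    have "(\<lambda>N. q (s (m N) - s (n N)) x) \<longlonglongrightarrow> 0" for x
    proof (rule LIMSEQ_I)
      fix r :: real assume r: "r > 0"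
      obtain N where N: "\<And>m n. m \<ge> N \<Longrightarrow> n \<ge> N \<Longrightarrow> nrm (s m - s n) < r / (nrm x + 1)"
        using C[of "r / (nrm x + 1)"] r by (auto simp: add_nonneg_pos)
      have "norm (q (s (m k) - s (n k)) x - 0) < r" if "k \<ge> N" for k
      proof -
        have "nrm (s (m k) - s (n k)) < r / (nrm x + 1)"
          using N that mn(1,2)[of k] by force
        then have a: "nrm (s (m k) - s (n k)) * (nrm x + 1) < r"
          by (simp add: pos_less_divide_eq add_nonneg_pos)
        have "cmod (q (s (m k) - s (n k)) x) \<le> nrm (s (m k) - s (n k)) * nrm x"
          by (rule q_le)
        also have "\<dots> \<le> nrm (s (m k) - s (n k)) * (nrm x + 1)"
          by (simp add: mult_left_mono)
        finally show ?thesis using a by simp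
      qed
      then show "\<exists>no. \<forall>k\<ge>no. norm (q (s (m k) - s (n k)) x - 0) < r" by blast
    qed
    then have "limitin (sigma_FE pair) (\<lambda>N. A (s (m N)) - A (s (n N))) 0 sequentially"
      by (simp add: limitin_sigma_FE q_def A_diff)
    with U have "\<forall>\<^sub>F N in sequentially. A (s (m N)) - A (s (n N)) \<in> U"
      by (auto simp: limitin_def)
    then show False using mn(3) by (auto simp: eventually_sequentially)
  qed
  then obtain f where "limitin (sigma_FE pair) (\<lambda>n. A (s n)) f sequentially"
    using seq_complete by (auto simp: weak_star_seq_complete_def)
  then have "\<forall>x. (\<lambda>n. q (s n) x) \<longlonglongrightarrow> pair f x"
    by (simp add: limitin_sigma_FE q_def)
  then have "approx s f" unfolding approx_def using C by blast
  then show ?thesis ..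
qed

lemma approx_Cauchy:
  "\<lbrakk>approx s f; e > 0\<rbrakk> \<Longrightarrow> \<exists>N. \<forall>m\<ge>N. \<forall>n\<ge>N. nrm (s m - s n) < e"
  by (simp add: approx_def)

lemma approx_range: "approx (\<lambda>_. x) (A x)"
  by (auto simp: approx_def q_def nrm_def)

lemma approx_add: assumes "approx s f" "approx t g" shows "approx (\<lambda>n. s n + t n) (f + g)"
  unfolding approx_def
proof (intro conjI strip)
  fix e :: real assume "e > 0"
  then have e: "e/2 > 0" by simp
  obtain M where M: "\<And>m n. m \<ge> M \<Longrightarrow> n \<ge> M \<Longrightarrow> nrm (s m - s n) < e/2"
    using approx_Cauchy[OF assms(1) e] by blast
  obtain N where N: "\<And>m n. m \<ge> N \<Longrightarrow> n \<ge> N \<Longrightarrow> nrm (t m - t n) < e/2"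
    using approx_Cauchy[OF assms(2) e] by blast
  have "nrm (s m + t m - (s n + t n)) < e" if "m \<ge> max M N" "n \<ge> max M N" for m n
    using nrm_triangle[of "s m - s n" "t m - t n"] M[of m n] N[of m n] that
    by (simp add: algebra_simps)
  then show "\<exists>N. \<forall>m\<ge>N. \<forall>n\<ge>N. nrm (s m + t m - (s n + t n)) < e" by blast
next
  fix x show "(\<lambda>n. q (s n + t n) x) \<longlonglongrightarrow> pair (f + g) x"
    using assms by (auto simp: approx_def q_simps pair_add_left intro!: tendsto_add)
qed

lemma nrm_scale: "nrm (scaleE c x) = cmod c * nrm x"
proof -
  have "q (scaleE c x) (scaleE c x) = (c * cnj c) * q x x"
    by (simp add: q_simps)
  also have "\<dots> = of_real ((cmod c)\<^sup>2 * (nrm x)\<^sup>2)"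
    by (simp only: q_self of_real_mult complex_norm_square)
  finally have "(nrm (scaleE c x))\<^sup>2 = (cmod c * nrm x)\<^sup>2"
    by (simp only: q_self of_real_eq_iff power_mult_distrib)
  then show ?thesis by (rule power2_eq_imp_eq) auto
qed

lemma approx_scale: assumes "approx s f" shows "approx (\<lambda>n. scaleE c (s n)) (scaleF c f)"
  unfolding approx_def
proof (intro conjI strip)
  fix e :: real assume e: "e > 0"
  then obtain M where M: "\<And>m n. m \<ge> M \<Longrightarrow> n \<ge> M \<Longrightarrow> nrm (s m - s n) < e / (cmod c + 1)"
    using approx_Cauchy[OF assms, of "e / (cmod c + 1)"] by (auto simp: add_nonneg_pos)
  have "nrm (scaleE c (s m) - scaleE c (s n)) < e" if "m \<ge> M" "n \<ge> M" for m n
  proof -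
    have "nrm (s m - s n) * (cmod c + 1) < e"
      using M[OF that] by (simp add: pos_less_divide_eq add_nonneg_pos)
    moreover have "cmod c * nrm (s m - s n) \<le> nrm (s m - s n) * (cmod c + 1)"
      by (simp add: algebra_simps)
    ultimately show ?thesis
      by (simp flip: E.scale_right_diff_distrib add: nrm_scale)
  qed
  then show "\<exists>N. \<forall>m\<ge>N. \<forall>n\<ge>N. nrm (scaleE c (s m) - scaleE c (s n)) < e" by blast
next
  fix x show "(\<lambda>n. q (scaleE c (s n)) x) \<longlonglongrightarrow> pair (scaleF c f) x"
    using assms by (auto simp: approx_def q_simps pair_scale_left intro!: tendsto_mult_left)
qed

lemma approx_diff: assumes "approx s f" "approx t g" shows "approx (\<lambda>n. s n - t n) (f - g)"
  using approx_add[OF assms(1) approx_scale[OF assms(2), of "-1"]] by simp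

lemma approx_unif:
  assumes "approx s f" "e > 0"
  shows "\<exists>N. \<forall>n\<ge>N. \<forall>x. cmod (pair f x - q (s n) x) \<le> e * nrm x"
proof -
  obtain N where N: "\<And>m n. m \<ge> N \<Longrightarrow> n \<ge> N \<Longrightarrow> nrm (s m - s n) < e"
    using approx_Cauchy[OF assms] by auto
  have "cmod (pair f x - q (s n) x) \<le> e * nrm x" if n: "n \<ge> N" for n x
  proof (rule LIMSEQ_le_const2)
    show "(\<lambda>m. cmod (q (s m) x - q (s n) x)) \<longlonglongrightarrow> cmod (pair f x - q (s n) x)"
      using assms(1) by (auto simp: approx_def intro!: tendsto_intros)
    have "cmod (q (s m) x - q (s n) x) \<le> e * nrm x" if "m \<ge> N" for m
      using q_le[of "s m - s n" x] N[OF that n] mult_right_mono[of "nrm (s m - s n)" e "nrm x"]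
      by (simp add: q_simps)
    then show "\<exists>N. \<forall>m\<ge>N. cmod (q (s m) x - q (s n) x) \<le> e * nrm x" by blast
  qed
  then show ?thesis by blast
qed

lemma approx_bounded: assumes "approx t g" shows "\<exists>C>0. \<forall>\<^sub>F n in sequentially. nrm (t n) \<le> C"
proof -
  obtain N where N: "\<And>m n. m \<ge> N \<Longrightarrow> n \<ge> N \<Longrightarrow> nrm (t m - t n) < 1"
    using approx_Cauchy[OF assms, of 1] by auto
  have "nrm (t n) \<le> 1 + nrm (t N)" if "n \<ge> N" for n
    using nrm_triangle[of "t n - t N" "t N"] N[of n N] that by simp
  moreover have "1 + nrm (t N) > 0" by (simp add: add_pos_nonneg)
  ultimately show ?thesis unfolding eventually_sequentially by blast
qed

lemma approx_pair_q:
  assumes "approx s f" "approx t g" shows "(\<lambda>n. pair f (t n) - q (s n) (t n)) \<longlonglongrightarrow> 0"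
proof (rule LIMSEQ_I)
  fix e :: real assume e: "e > 0"
  obtain C where C: "C > 0" "\<forall>\<^sub>F n in sequentially. nrm (t n) \<le> C"
    using approx_bounded[OF assms(2)] by blast
  obtain N where N: "\<forall>n\<ge>N. \<forall>x. cmod (pair f x - q (s n) x) \<le> e/(2*C) * nrm x"
    using approx_unif[OF assms(1), of "e/(2*C)"] e C by auto
  have "\<forall>\<^sub>F n in sequentially. norm (pair f (t n) - q (s n) (t n) - 0) < e"
    using C(2) eventually_ge_at_top[of N]
  proof eventually_elim
    case (elim n)
    have "cmod (pair f (t n) - q (s n) (t n)) \<le> e/(2*C) * nrm (t n)" using N elim by blast
    also have "\<dots> \<le> e/(2*C) * C" using elim e C by (intro mult_left_mono) auto
    also have "\<dots> < e" using e C by simp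
    finally show ?case by simp
  qed
  then show "\<exists>no. \<forall>n\<ge>no. norm (pair f (t n) - q (s n) (t n) - 0) < e"
    by (simp add: eventually_sequentially)
qed

lemma approx_convergent: assumes "approx s f" "approx t g" shows "convergent (\<lambda>n. pair f (t n))"
proof (rule Cauchy_convergent, rule CauchyI)
  fix e :: real assume e: "e > 0"
  obtain N where N: "\<forall>n\<ge>N. \<forall>x. cmod (pair f x - q (s n) x) \<le> 1 * nrm x"
    using approx_unif[OF assms(1), of 1] by auto
  define D where "D = 1 + nrm (s N)"
  have D: "D > 0" by (simp add: D_def add_pos_nonneg)
  have b: "cmod (pair f x) \<le> D * nrm x" for x
    using N[rule_format, of N x] q_le[of "s N" x] norm_triangle_sub[of "pair f x" "q (s N) x"]
    by (simp add: D_def algebra_simps)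
  obtain M where M: "\<And>m n. m \<ge> M \<Longrightarrow> n \<ge> M \<Longrightarrow> nrm (t m - t n) < e / D"
    using approx_Cauchy[OF assms(2), of "e / D"] e D by auto
  have "norm (pair f (t m) - pair f (t n)) < e" if "m \<ge> M" "n \<ge> M" for m n
    using b[of "t m - t n"] M[OF that] D by (simp add: pair_diff_right field_simps)
  then show "\<exists>M. \<forall>m\<ge>M. \<forall>n\<ge>M. norm (pair f (t m) - pair f (t n)) < e" by blast
qed

lemma approx_null: assumes "approx s 0" shows "(\<lambda>n. nrm (s n)) \<longlonglongrightarrow> 0"
proof (rule LIMSEQ_I)
  fix e :: real assume e: "e > 0"
  obtain N where N: "\<forall>n\<ge>N. \<forall>x. cmod (pair 0 x - q (s n) x) \<le> e/2 * nrm x"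
    using approx_unif[OF assms, of "e/2"] e by auto
  have "norm (nrm (s n) - 0) < e" if "n \<ge> N" for n
  proof -
    have "nrm (s n) * nrm (s n) \<le> e/2 * nrm (s n)"
      using N[rule_format, OF that, of "s n"] by (simp add: q_self norm_power power2_eq_square norm_mult)
    then have "nrm (s n) \<le> e/2" using e
      by (cases "nrm (s n) = 0") (auto simp: mult_le_cancel_right less_le)
    then show ?thesis using e by simp
  qed
  then show "\<exists>no. \<forall>n\<ge>no. norm (nrm (s n) - 0) < e" by blast
qed

definition "ip f g = lim (\<lambda>n. pair f ((SOME t. approx t g) n))"

lemma ip_lim: assumes "approx s f" "approx t g"
  shows "(\<lambda>n. q (s n) (t n)) \<longlonglongrightarrow> ip f g"
proof -
  define t' where "t' = (SOME t. approx t g)"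
  have t': "approx t' g" unfolding t'_def by (rule someI[of "\<lambda>t. approx t g", OF assms(2)])
  have "(\<lambda>n. pair f (t' n)) \<longlonglongrightarrow> ip f g"
    using approx_convergent[OF assms(1) t'] by (simp add: ip_def t'_def convergent_LIMSEQ_iff)
  from tendsto_diff[OF this approx_pair_q[OF assms(1) t']]
  have 1: "(\<lambda>n. q (s n) (t' n)) \<longlonglongrightarrow> ip f g" by simp
  have 2: "(\<lambda>n. nrm (t n - t' n)) \<longlonglongrightarrow> 0"
    using approx_null approx_diff[OF assms(2) t'] by simp
  obtain C where C: "C > 0" "\<forall>\<^sub>F n in sequentially. nrm (s n) \<le> C"
    using approx_bounded[OF assms(1)] by blast
  have "(\<lambda>n. q (s n) (t n - t' n)) \<longlonglongrightarrow> 0"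
  proof (rule Lim_null_comparison)
    show "\<forall>\<^sub>F n in sequentially. norm (q (s n) (t n - t' n)) \<le> C * nrm (t n - t' n)"
      using C(2) by eventually_elim (meson q_le mult_right_mono nrm_nonneg order_trans)
    show "(\<lambda>n. C * nrm (t n - t' n)) \<longlonglongrightarrow> 0" using tendsto_mult_left[OF 2, of C] by simp
  qed
  from tendsto_add[OF this 1] show ?thesis by (simp add: q_simps)
qed

definition "HA = \<lparr>hcarrier = {f. \<exists>s. approx s f}, hscale = scaleF, hinner = ip\<rparr>"

lemma HA_simps [simp]: "f \<in> hcarrier HA \<longleftrightarrow> (\<exists>s. approx s f)" "hscale HA = scaleF" "hinner HA = ip"
  by (simp_all add: HA_def)

lemma approx_mem: "approx s f \<Longrightarrow> f \<in> hcarrier HA"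
  by auto

lemmas range_mem = approx_mem[OF approx_range]

lemma hdist_lim: assumes "approx s f" "approx t g"
  shows "(\<lambda>n. nrm (s n - t n)) \<longlonglongrightarrow> hdist HA f g"
proof -
  have "hdist HA f g = sqrt (Re (ip (f - g) (f - g)))"
    using assms by (auto simp: hdist_def)
  moreover have "(\<lambda>n. sqrt (Re (q (s n - t n) (s n - t n)))) \<longlonglongrightarrow> sqrt (Re (ip (f - g) (f - g)))"
    by (intro tendsto_intros ip_lim approx_diff assms)
  ultimately show ?thesis by (simp add: nrm_def)
qed

lemma ip_definite: assumes "approx s f" "ip f f = 0" shows "f = 0"
proof (rule F_eqI)
  fix x
  have "(\<lambda>n. sqrt (Re (q (s n) (s n)))) \<longlonglongrightarrow> sqrt (Re 0)"
    by (intro tendsto_intros ip_lim[OF assms(1,1), unfolded assms(2)])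
  then have "(\<lambda>n. nrm (s n)) \<longlonglongrightarrow> 0" by (simp add: nrm_def)
  from tendsto_mult_right[OF this, of "nrm x"] have 0: "(\<lambda>n. nrm (s n) * nrm x) \<longlonglongrightarrow> 0" by simp
  have "(\<lambda>n. q (s n) x) \<longlonglongrightarrow> 0"
    by (rule Lim_null_comparison[OF _ 0]) (simp add: q_le)
  moreover have "(\<lambda>n. q (s n) x) \<longlonglongrightarrow> pair f x" using assms(1) by (simp add: approx_def)
  ultimately show "pair f x = pair 0 x" by (simp add: LIMSEQ_unique)
qed

lemma HA_metric: "Metric_space (hcarrier HA) (hdist HA)"
proof
  show nn: "0 \<le> hdist HA x y" for x y
  proof (cases "x \<in> hcarrier HA \<and> y \<in> hcarrier HA")
    case True
    then obtain s t where "approx s x" "approx t y" by auto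
    from hdist_lim[OF this] show ?thesis by (rule LIMSEQ_le_const) auto
  qed (auto simp: hdist_def)
  show "hdist HA x y = hdist HA y x" for x y
  proof (cases "x \<in> hcarrier HA \<and> y \<in> hcarrier HA")
    case True
    then obtain s t where st: "approx s x" "approx t y" by auto
    show ?thesis using LIMSEQ_unique[OF hdist_lim[OF st]] hdist_lim[OF st(2,1)]
      by (simp add: nrm_minus)
  qed (auto simp: hdist_def)
  show "hdist HA x z \<le> hdist HA x y + hdist HA y z"
    if "x \<in> hcarrier HA" "y \<in> hcarrier HA" "z \<in> hcarrier HA" for x y z
  proof -
    obtain r s t where a: "approx r x" "approx s y" "approx t z" using \<open>x \<in> _\<close> \<open>y \<in> _\<close> \<open>z \<in> _\<close> by auto
    have "nrm (r n - t n) \<le> nrm (r n - s n) + nrm (s n - t n)" for n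
      using nrm_triangle[of "r n - s n" "s n - t n"] by simp
    then show ?thesis
      by (intro LIMSEQ_le[OF hdist_lim[OF a(1,3)] tendsto_add[OF hdist_lim[OF a(1,2)] hdist_lim[OF a(2,3)]]])
        auto
  qed
  show "hdist HA x y = 0 \<longleftrightarrow> x = y" if xy: "x \<in> hcarrier HA" "y \<in> hcarrier HA" for x y
  proof -
    obtain s t where st: "approx s x" "approx t y" using xy by auto
    have d: "approx (\<lambda>n. s n - t n) (x - y)" by (rule approx_diff[OF st])
    have "x = y" if 0: "hdist HA x y = 0"
    proof -
      have "(\<lambda>n. complex_of_real ((nrm (s n - t n))\<^sup>2)) \<longlonglongrightarrow> of_real (0\<^sup>2)"
        using hdist_lim[OF st] 0 by (intro tendsto_intros) auto
      then have "ip (x - y) (x - y) = 0"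
        using ip_lim[OF d d] LIMSEQ_unique by (fastforce simp: q_self)
      with ip_definite[OF d] show ?thesis by simp
    qed
    moreover have "hdist HA x x = 0"
      using hdist_lim[OF st(1,1)] LIMSEQ_unique[of "\<lambda>_. 0"] by (auto simp: nrm_def q_simps)
    ultimately show ?thesis by blast
  qed
qed

lemma approx_dist_small:
  assumes "approx s f" "e > 0" shows "\<exists>N. \<forall>n\<ge>N. hdist HA (A (s n)) f < e"
proof -
  obtain N where N: "\<And>m n. m \<ge> N \<Longrightarrow> n \<ge> N \<Longrightarrow> nrm (s m - s n) < e/2"
    using approx_Cauchy[OF assms(1), of "e/2"] assms(2) by auto
  have "hdist HA (A (s n)) f \<le> e/2" if "n \<ge> N" for n
  proof (rule LIMSEQ_le_const2[OF hdist_lim[OF approx_range assms(1)]])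
    show "\<exists>N. \<forall>m\<ge>N. nrm (s n - s m) \<le> e/2" using N[OF that] by (meson less_imp_le)
  qed
  moreover have "e/2 < e" using assms(2) by simp
  ultimately show ?thesis by (meson le_less_trans)
qed

lemma hdist_range: "hdist HA (A x) (A y) = nrm (x - y)"
  using LIMSEQ_unique[OF hdist_lim[OF approx_range approx_range] tendsto_const] .

lemma HA_complete: "Metric_space.mcomplete (hcarrier HA) (hdist HA)"
proof -
  interpret M: Metric_space "hcarrier HA" "hdist HA" by (rule HA_metric)
  show ?thesis
    unfolding M.mcomplete_def
  proof (intro strip)
    fix \<sigma> assume \<sigma>: "M.MCauchy \<sigma>"
    then have car: "\<sigma> n \<in> hcarrier HA" for n unfolding M.MCauchy_def by blast
    have "\<exists>x. hdist HA (A x) (\<sigma> n) < inverse (Suc n)" for n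
    proof -
      obtain s where "approx s (\<sigma> n)" using car[of n] by auto
      from approx_dist_small[OF this, of "inverse (Suc n)"] show ?thesis by auto
    qed
    then obtain s where s: "\<And>n. hdist HA (A (s n)) (\<sigma> n) < inverse (Suc n)" by metis
    have ran: "A x \<in> hcarrier HA" for x by (rule range_mem)
    have small: "\<exists>N. \<forall>n\<ge>N. inverse (real (Suc n)) < e" if e: "e > 0" for e :: real
    proof -
      obtain N where N: "inverse (real (Suc N)) < e" using reals_Archimedean[OF e] by blast
      have "inverse (real (Suc n)) \<le> inverse (real (Suc N))" if "n \<ge> N" for n
        using that by (intro le_imp_inverse_le) auto
      with N show ?thesis by (meson le_less_trans)
    qed
    have "\<exists>N. \<forall>m\<ge>N. \<forall>n\<ge>N. nrm (s m - s n) < e" if e: "e > 0" for e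
    proof -
      obtain N where N: "\<And>n. n \<ge> N \<Longrightarrow> inverse (real (Suc n)) < e/3" using small[of "e/3"] e by auto
      obtain K where K: "\<And>m n. m \<ge> K \<Longrightarrow> n \<ge> K \<Longrightarrow> hdist HA (\<sigma> m) (\<sigma> n) < e/3"
        using \<sigma> e unfolding M.MCauchy_def by (meson zero_less_divide_iff zero_less_numeral)
      have "nrm (s m - s n) < e" if mn: "m \<ge> max N K" "n \<ge> max N K" for m n
      proof -
        have "hdist HA (A (s m)) (A (s n)) \<le> hdist HA (A (s m)) (\<sigma> m) + hdist HA (\<sigma> m) (A (s n))"
          "hdist HA (\<sigma> m) (A (s n)) \<le> hdist HA (\<sigma> m) (\<sigma> n) + hdist HA (A (s n)) (\<sigma> n)"
          using M.triangle M.triangle' car ran by blast+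
        with s[of m] s[of n] N[of m] N[of n] K[of m n] mn show ?thesis by (simp add: hdist_range)
      qed
      then show ?thesis by blast
    qed
    then obtain f where f: "approx s f" using approx_exists by blast
    have fH: "f \<in> hcarrier HA" using f by (rule approx_mem)
    have "\<exists>N. \<forall>n\<ge>N. hdist HA (\<sigma> n) f < e" if e: "e > 0" for e
    proof -
      obtain N where N: "\<And>n. n \<ge> N \<Longrightarrow> inverse (real (Suc n)) < e/2" using small[of "e/2"] e by auto
      obtain K where K: "\<And>n. n \<ge> K \<Longrightarrow> hdist HA (A (s n)) f < e/2"
        using approx_dist_small[OF f, of "e/2"] e by auto
      have "hdist HA (\<sigma> n) f < e" if "n \<ge> max N K" for n
        using M.triangle[OF car ran fH, of n "s n"] M.commute[of "\<sigma> n" "A (s n)"] s[of n] N[of n] K[of n] that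
        by simp
      then show ?thesis by blast
    qed
    then have "limitin M.mtopology \<sigma> f sequentially"
      unfolding M.limit_metric_sequentially using car fH by blast
    then show "\<exists>f. limitin M.mtopology \<sigma> f sequentially" ..
  qed
qed

lemma HA_hilbert: "hilbert_space HA"
proof -
  have vs: "vector_space (hscale HA)" using F.vector_space_axioms by simp
  show ?thesis
  proof (intro hilbert_space.intro vs hilbert_space_axioms.intro)
    have "0 \<in> hcarrier HA" using range_mem[of 0] by simp
    moreover have "x + y \<in> hcarrier HA" if "x \<in> hcarrier HA" "y \<in> hcarrier HA" for x y
    proof -
      from that obtain s t where "approx s x" "approx t y" by auto
      from approx_add[OF this] show ?thesis by (rule approx_mem)
    qed
    moreover have "scaleF c x \<in> hcarrier HA" if "x \<in> hcarrier HA" for c x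
    proof -
      from that obtain s where "approx s x" by auto
      from approx_scale[OF this] show ?thesis by (rule approx_mem)
    qed
    ultimately show "module.subspace (hscale HA) (hcarrier HA)"
      unfolding F.subspace_def HA_simps(2) by blast
    show "hinner HA (x + y) z = hinner HA x z + hinner HA y z"
      if xyz: "x \<in> hcarrier HA" "y \<in> hcarrier HA" "z \<in> hcarrier HA" for x y z
    proof -
      obtain r s t where a: "approx r x" "approx s y" "approx t z" using xyz by auto
      show ?thesis
        using LIMSEQ_unique[OF ip_lim[OF approx_add[OF a(1,2)] a(3)]]
          tendsto_add[OF ip_lim[OF a(1,3)] ip_lim[OF a(2,3)]] by (simp add: q_simps)
    qed
    show "hinner HA (hscale HA c x) y = c * hinner HA x y"
      if xy: "x \<in> hcarrier HA" "y \<in> hcarrier HA" for x y c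
    proof -
      obtain r s where a: "approx r x" "approx s y" using xy by auto
      show ?thesis
        using LIMSEQ_unique[OF ip_lim[OF approx_scale[OF a(1)] a(2)]]
          tendsto_mult_left[OF ip_lim[OF a]] by (simp add: q_simps)
    qed
    show "hinner HA y x = cnj (hinner HA x y)"
      if xy: "x \<in> hcarrier HA" "y \<in> hcarrier HA" for x y
    proof -
      obtain r s where a: "approx r x" "approx s y" using xy by auto
      have "(\<lambda>n. q (s n) (r n)) \<longlonglongrightarrow> cnj (ip x y)"
        using tendsto_cnj[OF ip_lim[OF a]] by (simp flip: q_herm)
      then show ?thesis using LIMSEQ_unique[OF ip_lim[OF a(2,1)]] by simp
    qed
    show "hinner HA x x \<in> \<real>\<^sub>\<ge>\<^sub>0" if x: "x \<in> hcarrier HA" for x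
    proof -
      obtain s where "approx s x" using x by auto
      from ip_lim[OF this this] have "ip x x \<in> \<real>\<^sub>\<ge>\<^sub>0"
      proof (rule Lim_in_closed_set[OF closed_nonneg_Reals_complex, rotated 2])
        show "\<forall>\<^sub>F n in sequentially. q (s n) (s n) \<in> \<real>\<^sub>\<ge>\<^sub>0"
          unfolding q_self nonneg_Reals_of_real_iff by simp
      qed simp
      then show ?thesis by simp
    qed
    show "x = 0" if "x \<in> hcarrier HA" "hinner HA x x = 0" for x
      using that ip_definite by auto
    show "Metric_space.mcomplete (hcarrier HA) (hdist HA)" by (rule HA_complete)
  qed
qed

lemma ran_inner_eq: "ran_inner pair A (A x) (A y) = pair (A x) y"
  unfolding ran_inner_def
proof (rule the_equality)
  fix c assume "\<exists>x' y'. A x = A x' \<and> A y = A y' \<and> c = pair (A x') y'"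
  then obtain x' y' where "A x = A x'" "A y = A y'" "c = q x' y'" by (auto simp: q_def)
  then show "c = pair (A x) y" using q_herm[of x y] q_herm[of x y'] by (simp add: q_def)
qed blast

lemma completion: "aux_hilbert scaleF pair A HA id"
proof -
  interpret M: Metric_space "hcarrier HA" "hdist HA" by (rule HA_metric)
  have ran: "range A \<subseteq> hcarrier HA" using range_mem by blast
  have "ip (A x) (A y) = pair (A x) y" for x y
    using LIMSEQ_unique[OF ip_lim[OF approx_range approx_range] tendsto_const] by (simp add: q_def)
  moreover have "M.mtopology closure_of range A = hcarrier HA"
  proof -
    have "\<exists>y\<in>range A. y \<in> M.mball f e" if "f \<in> hcarrier HA" "e > 0" for f e
    proof -
      obtain s where "approx s f" using \<open>f \<in> _\<close> by auto
      from approx_dist_small[OF this \<open>e > 0\<close>] obtain n where "hdist HA (A (s n)) f < e" by blast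
      then have "A (s n) \<in> M.mball f e" using \<open>f \<in> _\<close> ran M.commute[of f "A (s n)"] by (auto simp del: HA_simps)
      then show ?thesis by blast
    qed
    then show ?thesis unfolding M.metric_closure_of by blast
  qed
  ultimately show ?thesis
    unfolding hilbert_completion_def linear_on_def
    using ran HA_hilbert by (auto simp: ran_inner_eq simp del: HA_simps(1))
qed

end

lemma aux_hilbert_exists:
  fixes scaleF :: "complex \<Rightarrow> 'f::ab_group_add \<Rightarrow> 'f"
  assumes "anti_dual_pair scaleE scaleF pair" "weak_star_seq_complete pair"
    "positive_op scaleE scaleF pair A"
  shows "\<exists>(H :: 'f hilbert) \<iota>. aux_hilbert scaleF pair A H \<iota>"
proof -
  interpret positive_operator scaleE scaleF pair A
    using assms by (intro positive_operator.intro positive_operator_axioms.intro)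
  show ?thesis using completion by blast
qed

end

theory Submission
  imports Defs
begin

text \<open>Positive operators are determined by their quadratic forms, and by polarization pointwise
  convergence of the forms suffices. The form of \<open>(nA):B\<close> at \<open>x\<close> is the infimum over \<open>z\<close> of
  \<open>n \<langle>Az, z\<rangle> + \<langle>B(x - z), x - z\<rangle>\<close>; it increases with \<open>n\<close>, and the growing penalty drives \<open>Az\<close> to \<open>0\<close>
  in \<open>\<H>\<^sub>A\<close>, so that in the limit \<open>Bz\<close> is only constrained to lie in \<open>\<M>\<close>. Hence the forms converge
  to the squared distance of \<open>Bx\<close> from \<open>\<M>\<close>, which is \<open>\<parallel>(I - P)Bx\<parallel>\<^sup>2 = \<langle>J\<^sub>B(I - P)J\<^sub>B\<^sup>*x, x\<rangle>\<close>.\<close>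

section \<open>Weak topologies\<close>

text \<open>The objects \<open>parallel_sum\<close>, \<open>J_op\<close>, \<open>adjoint_op\<close>,
  \<open>orth_proj\<close> and \<open>parallel_limit\<close> are definite descriptions, so each is
  usable only after a witness has been constructed and shown unique. The obstacle is that
  \<open>E\<close> has no completeness: the infima are in general not attained there, and new
  elements of \<open>F\<close> come only from \<open>approx_exists\<close>, that is, from weak
  limits along Cauchy sequences for a seminorm \<open>nrm\<close>. The parallelogram law supplies
  such sequences: two near-minimizers, even for different weights, are as close as the gap between
  their minimal energies allows. With constant weight this constructs \<open>A:B\<close>; with the
  weights \<open>n\<close> it constructs the point of \<open>M\<close> closest to \<open>Bx\<close>,
  so that the same limit process also produces the value of the projection.\<close>

lemma topspace_weak_topology [simp]: "topspace (weak_topology S I \<phi>) = S"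
  by (auto simp: weak_topology_def topspace_pullback_topology)

lemma continuous_map_into_weak_topology:
  assumes "\<And>v. v \<in> topspace X \<Longrightarrow> g v \<in> S"
    and "\<And>i. i \<in> I \<Longrightarrow> continuous_map X euclidean (\<lambda>v. \<phi> (g v) i)"
  shows "continuous_map X (weak_topology S I \<phi>) g"
  unfolding weak_topology_def
proof (rule continuous_map_pullback')
  have "continuous_map X euclidean (\<lambda>v. restrict (\<phi> (g v)) I i)" if "i \<in> I" for i
    using assms(2)[OF that] that by simp
  then show "continuous_map X (product_topology (\<lambda>_. euclidean) I) ((\<lambda>v. restrict (\<phi> v) I) \<circ> g)"
    unfolding continuous_map_componentwise by auto
qed (use assms(1) in auto)

lemma continuous_map_weak_topology_component:
  assumes "i \<in> I"
  shows "continuous_map (weak_topology S I \<phi>) euclidean (\<lambda>v. \<phi> v i)"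
proof -
  have "continuous_map (weak_topology S I \<phi>) euclidean ((\<lambda>w. w i) \<circ> (\<lambda>v. restrict (\<phi> v) I))"
    unfolding weak_topology_def
    by (intro continuous_map_pullback continuous_map_product_projection assms)
  then show ?thesis using assms by (simp add: o_def)
qed

lemma limitin_weak_topology:
  assumes "\<And>n. s n \<in> S" "h \<in> S" "\<And>i. i \<in> I \<Longrightarrow> (\<lambda>n. \<phi> (s n) i) \<longlonglongrightarrow> \<phi> h i"
  shows "limitin (weak_topology S I \<phi>) s h sequentially"
  unfolding limitin_def
proof (intro conjI strip)
  fix U assume U: "openin (weak_topology S I \<phi>) U \<and> h \<in> U"
  then obtain V where V: "openin (product_topology (\<lambda>_. euclidean) I) V"
      "U = (\<lambda>v. restrict (\<phi> v) I) -` V \<inter> S"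
    by (auto simp: weak_topology_def openin_pullback_topology)
  have "limitin (product_topology (\<lambda>_. euclidean) I) (\<lambda>n. restrict (\<phi> (s n)) I)
      (restrict (\<phi> h) I) sequentially"
    using assms(3) by (simp add: limitin_componentwise)
  then have "\<forall>\<^sub>F n in sequentially. restrict (\<phi> (s n)) I \<in> V"
    using V U by (auto simp: limitin_def)
  then show "\<forall>\<^sub>F n in sequentially. s n \<in> U" using assms(1) V(2) by simp
qed (use assms(2) in simp)

section \<open>Hilbert spaces\<close>

context hilbert_space
begin

lemma hcarrier_closed [simp]:
  "0 \<in> hcarrier H" "x \<in> hcarrier H \<Longrightarrow> hscale H c x \<in> hcarrier H"
  "\<lbrakk>x \<in> hcarrier H; y \<in> hcarrier H\<rbrakk> \<Longrightarrow> x + y \<in> hcarrier H"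
  "\<lbrakk>x \<in> hcarrier H; y \<in> hcarrier H\<rbrakk> \<Longrightarrow> x - y \<in> hcarrier H"
  using subspace_hcarrier by (auto intro: subspace_0 subspace_scale subspace_add subspace_diff)

lemma hinner_diff_left: "\<lbrakk>x \<in> hcarrier H; y \<in> hcarrier H; z \<in> hcarrier H\<rbrakk>
    \<Longrightarrow> hinner H (x - y) z = hinner H x z - hinner H y z"
  using hinner_add_left[of "x - y" y z] by simp

lemma hinner_add_right: "\<lbrakk>x \<in> hcarrier H; y \<in> hcarrier H; z \<in> hcarrier H\<rbrakk>
    \<Longrightarrow> hinner H z (x + y) = hinner H z x + hinner H z y"
  by (simp add: hinner_add_left hinner_commute[of _ z])

lemma hinner_diff_right: "\<lbrakk>x \<in> hcarrier H; y \<in> hcarrier H; z \<in> hcarrier H\<rbrakk>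
    \<Longrightarrow> hinner H z (x - y) = hinner H z x - hinner H z y"
  by (simp add: hinner_diff_left hinner_commute[of _ z])

lemma hinner_scale_right: "\<lbrakk>x \<in> hcarrier H; y \<in> hcarrier H\<rbrakk>
    \<Longrightarrow> hinner H y (hscale H c x) = cnj c * hinner H y x"
  by (simp add: hinner_scale_left hinner_commute[of _ y])

lemmas hinner_simps = hinner_add_left hinner_diff_left hinner_add_right hinner_diff_right
  hinner_scale_left hinner_scale_right

definition hnorm :: "'h \<Rightarrow> real" where "hnorm x = sqrt (Re (hinner H x x))"

lemma hnorm_nonneg [simp]: "x \<in> hcarrier H \<Longrightarrow> 0 \<le> hnorm x"
  using hinner_nonneg[of x] by (simp add: hnorm_def complex_nonneg_Reals_iff)

lemma hinner_self: "x \<in> hcarrier H \<Longrightarrow> hinner H x x = of_real ((hnorm x)\<^sup>2)"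
  using hinner_nonneg[of x] by (simp add: hnorm_def complex_nonneg_Reals_iff complex_eq_iff)

lemma hnorm_zero [simp]: "hnorm 0 = 0"
  using hinner_diff_left[of 0 0 0] by (simp add: hnorm_def)

lemma hnorm_eq_0: "x \<in> hcarrier H \<Longrightarrow> hnorm x = 0 \<longleftrightarrow> x = 0"
  using hinner_definite[of x] hinner_self[of x] by auto

lemma hdist_eq_hnorm: "\<lbrakk>x \<in> hcarrier H; y \<in> hcarrier H\<rbrakk> \<Longrightarrow> hdist H x y = hnorm (x - y)"
  by (simp add: hdist_def hnorm_def)

lemma hnorm_commute: "\<lbrakk>x \<in> hcarrier H; y \<in> hcarrier H\<rbrakk> \<Longrightarrow> hnorm (x - y) = hnorm (y - x)"
  by (simp add: hnorm_def hinner_simps)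

text \<open>Pythagoras for the component of \<open>x\<close> along \<open>m\<close>. Nonnegativity
  of the left side yields the Cauchy-Schwarz inequality, and the strict drop when
  \<open>hinner H x m\<close> is nonzero yields the orthogonality of minimizers.\<close>

lemma hnorm_component_removed:
  assumes x: "x \<in> hcarrier H" and m: "m \<in> hcarrier H" "m \<noteq> 0"
  shows "(hnorm (x - hscale H (hinner H x m / hinner H m m) m))\<^sup>2
    = (hnorm x)\<^sup>2 - (cmod (hinner H x m))\<^sup>2 / (hnorm m)\<^sup>2"
proof -
  define c where "c = hinner H x m / hinner H m m"
  have m0: "hinner H m m \<noteq> 0" and cm: "cnj (hinner H m m) = hinner H m m"
    using hinner_definite m by (auto simp: hinner_self)
  have "complex_of_real ((hnorm (x - hscale H c m))\<^sup>2) = hinner H (x - hscale H c m) (x - hscale H c m)"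
    using x m by (intro hinner_self[symmetric]) simp
  also have "\<dots> = hinner H x x + c * cnj c * hinner H m m - c * hinner H m x - cnj c * hinner H x m"
    using x m by (simp add: hinner_simps algebra_simps)
  also have "\<dots> = hinner H x x - hinner H x m * cnj (hinner H x m) / hinner H m m"
    using m0 cm hinner_commute[OF x m(1)] by (simp add: c_def field_simps)
  also have "\<dots> = of_real ((hnorm x)\<^sup>2 - (cmod (hinner H x m))\<^sup>2 / (hnorm m)\<^sup>2)"
    using x m by (simp add: hinner_self complex_mult_cnj cmod_power2)
  finally show ?thesis unfolding of_real_eq_iff c_def .
qed

lemma Cauchy_Schwarz_hinner:
  assumes "x \<in> hcarrier H" "y \<in> hcarrier H"
  shows "cmod (hinner H x y) \<le> hnorm x * hnorm y"
proof (cases "y = 0")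
  case True
  then show ?thesis using assms hinner_diff_right[of 0 0 x] by simp
next
  case False
  have "0 \<le> (hnorm x)\<^sup>2 - (cmod (hinner H x y))\<^sup>2 / (hnorm y)\<^sup>2"
    using hnorm_component_removed[OF assms False] by (metis zero_le_power2)
  moreover have "hnorm y > 0" using False assms hnorm_eq_0 by (simp add: less_le)
  ultimately have "(cmod (hinner H x y))\<^sup>2 \<le> (hnorm x * hnorm y)\<^sup>2"
    by (simp add: field_simps)
  then show ?thesis using assms by (intro power2_le_imp_le[of "cmod _"]) auto
qed

lemma hnorm_triangle:
  assumes "x \<in> hcarrier H" "y \<in> hcarrier H"
  shows "hnorm (x + y) \<le> hnorm x + hnorm y"
proof (rule power2_le_imp_le)
  have "(hnorm (x + y))\<^sup>2 = Re (hinner H (x + y) (x + y))"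
    using assms by (simp only: hinner_self hcarrier_closed Re_complex_of_real)
  also have "\<dots> = Re (hinner H x x) + Re (hinner H y y) + 2 * Re (hinner H x y)"
    using assms hinner_commute[of x y] by (simp add: hinner_simps)
  also have "\<dots> = (hnorm x)\<^sup>2 + (hnorm y)\<^sup>2 + 2 * Re (hinner H x y)"
    using assms by (simp only: hinner_self Re_complex_of_real)
  also have "\<dots> \<le> (hnorm x + hnorm y)\<^sup>2"
    using Cauchy_Schwarz_hinner[OF assms] complex_Re_le_cmod[of "hinner H x y"]
    by (simp add: power2_sum)
  finally show "(hnorm (x + y))\<^sup>2 \<le> (hnorm x + hnorm y)\<^sup>2" .
qed (use assms in auto)

lemma hnorm_scale:
  assumes "x \<in> hcarrier H"
  shows "hnorm (hscale H c x) = cmod c * hnorm x"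
proof -
  have "complex_of_real ((hnorm (hscale H c x))\<^sup>2) = (c * cnj c) * hinner H x x"
    using assms by (simp add: hinner_simps del: of_real_power flip: hinner_self)
  also have "\<dots> = of_real ((cmod c)\<^sup>2 * (hnorm x)\<^sup>2)"
    using assms by (simp only: hinner_self of_real_mult complex_norm_square)
  finally have "(hnorm (hscale H c x))\<^sup>2 = (cmod c * hnorm x)\<^sup>2"
    by (simp only: of_real_eq_iff power_mult_distrib)
  then show ?thesis by (rule power2_eq_imp_eq) (use assms in auto)
qed

lemma Metric_space_hdist: "Metric_space (hcarrier H) (hdist H)"
proof
  show "hdist H x z \<le> hdist H x y + hdist H y z"
    if "x \<in> hcarrier H" "y \<in> hcarrier H" "z \<in> hcarrier H" for x y z
    using hnorm_triangle[of "x - y" "y - z"] that by (simp add: hdist_eq_hnorm)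
  show "hdist H x y = hdist H y x" for x y
    using hnorm_commute[of x y] by (auto simp: hdist_def hnorm_def)
  show "0 \<le> hdist H x y" for x y
    using hnorm_nonneg[of "x - y"] by (auto simp: hdist_def hnorm_def)
qed (auto simp: hdist_eq_hnorm hnorm_eq_0)

lemma tendsto_hinner:
  assumes "\<And>n. s n \<in> hcarrier H" "h \<in> hcarrier H" "k \<in> hcarrier H"
    and "(\<lambda>n. hnorm (s n - h)) \<longlonglongrightarrow> 0"
  shows "(\<lambda>n. hinner H (s n) k) \<longlonglongrightarrow> hinner H h k"
proof -
  have "(\<lambda>n. hinner H (s n) k - hinner H h k) \<longlonglongrightarrow> 0"
  proof (rule Lim_null_comparison)
    show "\<forall>\<^sub>F n in sequentially. norm (hinner H (s n) k - hinner H h k) \<le> hnorm (s n - h) * hnorm k"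
      using Cauchy_Schwarz_hinner[of "s _ - h" k] assms by (simp add: hinner_diff_left)
    show "(\<lambda>n. hnorm (s n - h) * hnorm k) \<longlonglongrightarrow> 0"
      using tendsto_mult_right[OF assms(4)] by simp
  qed
  then show ?thesis by (rule LIM_zero_cancel)
qed

lemma tendsto_hnorm:
  assumes "\<And>n. s n \<in> hcarrier H" "h \<in> hcarrier H"
    and "(\<lambda>n. hnorm (s n - h)) \<longlonglongrightarrow> 0"
  shows "(\<lambda>n. hnorm (s n)) \<longlonglongrightarrow> hnorm h"
proof -
  have "(\<lambda>n. hnorm (s n) - hnorm h) \<longlonglongrightarrow> 0"
  proof (rule Lim_null_comparison[OF _ assms(3)])
    have "\<bar>hnorm (s n) - hnorm h\<bar> \<le> hnorm (s n - h)" for n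
      using hnorm_triangle[of "s n - h" h] hnorm_triangle[of "h - s n" "s n"]
        hnorm_commute[of h "s n"] assms by simp
    then show "\<forall>\<^sub>F n in sequentially. norm (hnorm (s n) - hnorm h) \<le> hnorm (s n - h)" by simp
  qed
  then show ?thesis by (rule LIM_zero_cancel)
qed

lemma Cauchy_hnorm_convergent:
  assumes s: "\<And>n. s n \<in> hcarrier H"
    and C: "\<And>e. e > 0 \<Longrightarrow> \<exists>N. \<forall>m\<ge>N. \<forall>n\<ge>N. hnorm (s m - s n) < e"
  shows "\<exists>h\<in>hcarrier H. (\<lambda>n. hnorm (s n - h)) \<longlonglongrightarrow> 0"
proof -
  interpret M: Metric_space "hcarrier H" "hdist H" by (rule Metric_space_hdist)
  have "M.MCauchy s"
    unfolding M.MCauchy_def using s C by (auto simp: hdist_eq_hnorm)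
  then obtain h where h: "limitin M.mtopology s h sequentially"
    using complete unfolding M.mcomplete_def by blast
  then have "h \<in> hcarrier H" "(\<lambda>n. hdist H (s n) h) \<longlonglongrightarrow> 0"
    by (auto simp: M.limitin_metric_dist_null)
  then show ?thesis using s by (auto simp: hdist_eq_hnorm)
qed

text \<open>Removing from \<open>h - p\<close> its component along \<open>m\<close> amounts to
  moving \<open>p\<close> within \<open>M\<close>. By \<open>hnorm_component_removed\<close> this
  would shorten the distance unless the inner product vanishes.\<close>

lemma minimizer_orthogonal:
  assumes M: "subspace M" "M \<subseteq> hcarrier H" and h: "h \<in> hcarrier H" and p: "p \<in> M"
    and min: "\<And>m. m \<in> M \<Longrightarrow> hnorm (h - p) \<le> hnorm (h - m)"
    and m: "m \<in> M"
  shows "hinner H (h - p) m = 0"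
proof (cases "m = 0")
  case True
  then show ?thesis using Cauchy_Schwarz_hinner[of "h - p" m] h p M by auto
next
  case False
  let ?c = "hinner H (h - p) m / hinner H m m"
  have "p + hscale H ?c m \<in> M" using M(1) p m by (intro subspace_add subspace_scale)
  from min[OF this] have "hnorm (h - p) \<le> hnorm (h - p - hscale H ?c m)"
    by (simp add: algebra_simps)
  then have "(hnorm (h - p))\<^sup>2 \<le> (hnorm (h - p - hscale H ?c m))\<^sup>2"
    using h p M by (intro power_mono) auto
  also have "\<dots> = (hnorm (h - p))\<^sup>2 - (cmod (hinner H (h - p) m))\<^sup>2 / (hnorm m)\<^sup>2"
    using False h p m M by (intro hnorm_component_removed) auto
  finally have "(cmod (hinner H (h - p) m))\<^sup>2 / (hnorm m)\<^sup>2 \<le> 0" by simp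
  moreover have "hnorm m \<noteq> 0" using False m M hnorm_eq_0 by auto
  ultimately show ?thesis by (simp add: divide_le_0_iff)
qed

text \<open>The difference of two candidates lies in \<open>M\<close> and is orthogonal to
  \<open>M\<close>, hence to itself. The existence of \<open>p\<close> is left to the caller:
  \<open>min_energy_limit\<close> constructs it.\<close>

lemma orth_proj_eqI:
  assumes M: "subspace M" "M \<subseteq> hcarrier H" and h: "h \<in> hcarrier H" and p: "p \<in> M"
    and orth: "\<And>m. m \<in> M \<Longrightarrow> hinner H (h - p) m = 0"
  shows "orth_proj H M h = p"
  unfolding orth_proj_def
proof (rule the_equality)
  fix p' assume p': "p' \<in> M \<and> (\<forall>m\<in>M. hinner H (h - p') m = 0)"
  then have d: "p' - p \<in> M" using M p by (simp add: subspace_diff)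
  have "hinner H (p' - p) (p' - p) = hinner H (h - p) (p' - p) - hinner H (h - p') (p' - p)"
    using h p p' d M by (simp add: hinner_simps subsetD)
  also have "\<dots> = 0" using orth p' d by auto
  finally show "p' = p" using hinner_definite[of "p' - p"] d M by auto
qed (use p orth in blast)

end

section \<open>The auxiliary Hilbert space\<close>

context positive_operator
begin

text \<open>Hermitian symmetry turns \<open>pair (A x) y\<close> into the conjugate of
  \<open>pair (A y) x\<close>, and the latter is, as a function of \<open>x\<close>, one of the
  functionals that define \<open>sigma_EF\<close>.\<close>

lemma A_weak_op: "A \<in> weak_ops scaleE scaleF pair"
proof -
  have "continuous_map (sigma_EF pair) euclidean (\<lambda>x. cnj (pair (A y) x))" for y
  proof -
    have "continuous_map (sigma_EF pair) euclidean (\<lambda>x. pair (A y) x)"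
      by (rule continuous_map_weak_topology_component) simp
    moreover have "continuous_map euclidean euclidean cnj"
      using continuous_on_cnj[OF continuous_on_id, of UNIV] by simp
    ultimately have "continuous_map (sigma_EF pair) euclidean (cnj \<circ> (\<lambda>x. pair (A y) x))"
      by (rule continuous_map_compose)
    then show ?thesis by (simp add: o_def)
  qed
  moreover have "cnj (pair (A y) x) = pair (A x) y" for x y
    using q_herm[of x y] by (simp add: q_def)
  ultimately have "continuous_map (sigma_EF pair) (sigma_FE pair) A"
    by (intro continuous_map_into_weak_topology) simp_all
  then show ?thesis using A_linear by (simp add: weak_ops_def)
qed

lemma q_polarization:
  "4 * q x y = q (x + y) (x + y) - q (x - y) (x - y)
    + \<i> * q (x + scaleE \<i> y) (x + scaleE \<i> y) - \<i> * q (x - scaleE \<i> y) (x - scaleE \<i> y)"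
  by (simp add: q_simps algebra_simps)

lemma nrm_power2: "(nrm x)\<^sup>2 = Re (q x x)"
  by (simp add: nrm_def q_nonneg)

lemma nrm_add_power2: "(nrm (x + y))\<^sup>2 = (nrm x)\<^sup>2 + 2 * Re (q x y) + (nrm y)\<^sup>2"
  using q_herm[of x y] by (simp add: nrm_power2 q_simps)

lemma nrm_midpoint_power2:
  "(nrm (scaleE (1/2) (x + y)))\<^sup>2 = (nrm x)\<^sup>2 / 2 + (nrm y)\<^sup>2 / 2 - (nrm (x - y))\<^sup>2 / 4"
  by (simp add: nrm_power2 q_simps diff_divide_distrib add_divide_distrib)

lemma op_multiple_positive: "positive_op scaleE scaleF pair (op_multiple scaleF n A)"
proof -
  have "Vector_Spaces.linear scaleE scaleF (op_multiple scaleF n A)"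
    using E.vector_space_axioms F.vector_space_axioms
    by (simp add: Vector_Spaces.linear_iff op_multiple_def A_add A_scale F.scale_right_distrib
        F.scale_scale mult.commute)
  then show ?thesis
    using positive by (simp add: positive_op_def op_multiple_def pair_scale_left)
qed

lemma positive_op_tendsto:
  assumes T: "\<And>n. positive_op scaleE scaleF pair (T n)"
    and lim: "\<And>x. (\<lambda>n. pair (T n x) x) \<longlonglongrightarrow> pair (A x) x"
  shows "(\<lambda>n. pair (T n x) y) \<longlonglongrightarrow> pair (A x) y"
proof -
  interpret T: positive_operator scaleE scaleF pair "T n" for n
    by unfold_locales (use seq_complete T in auto)
  have "(\<lambda>n. 4 * T.q n x y) \<longlonglongrightarrow> 4 * q x y"
    unfolding q_polarization T.q_polarization
    by (intro tendsto_intros) (use lim in \<open>simp_all add: q_def T.q_def\<close>)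
  from tendsto_mult_left[OF this, of "1/4"] show ?thesis by (simp add: q_def T.q_def)
qed

lemma positive_op_eqI:
  assumes "positive_op scaleE scaleF pair T" and "\<And>x. pair (T x) x = pair (A x) x"
  shows "T = A"
  using positive_op_tendsto[of "\<lambda>_. T"] assms by (auto simp: LIMSEQ_const_iff intro!: F_eqI)

end

locale aux_space = positive_operator scaleE scaleF pair A
  for scaleE :: "complex \<Rightarrow> 'e::ab_group_add \<Rightarrow> 'e"
    and scaleF :: "complex \<Rightarrow> 'f::ab_group_add \<Rightarrow> 'f"
    and pair :: "'f \<Rightarrow> 'e \<Rightarrow> complex" and A +
  fixes H :: "'h::ab_group_add hilbert" and \<iota> :: "'f \<Rightarrow> 'h"
  assumes aux: "aux_hilbert scaleF pair A H \<iota>"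
begin

sublocale H: hilbert_space H
  using aux by (simp add: hilbert_completion_def)

text \<open>The vector written \<open>Ax\<close> in the Hilbert space. Indexing by \<open>x\<close>
  instead of by elements of \<open>range A\<close> avoids choosing preimages;
  \<open>adjoint_J_op\<close> identifies \<open>emb\<close> with the adjoint of
  \<open>J\<close>.\<close>

definition emb :: "'e \<Rightarrow> 'h" where "emb x = \<iota> (A x)"

lemma emb_mem [simp]: "emb x \<in> hcarrier H"
  using aux by (auto simp: hilbert_completion_def emb_def)

lemma emb_add: "emb (x + y) = emb x + emb y" and emb_scale: "emb (scaleE c x) = hscale H c (emb x)"
  using aux by (auto simp: hilbert_completion_def linear_on_def emb_def A_add A_scale)

lemma emb_diff: "emb (x - y) = emb x - emb y"
  using emb_add[of "x - y" y] by simp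

lemma emb_zero [simp]: "emb 0 = 0"
  using emb_diff[of 0 0] by simp

lemma hinner_emb: "hinner H (emb x) (emb y) = q x y"
  using aux by (auto simp: hilbert_completion_def emb_def q_def ran_inner_eq)

lemma hnorm_emb: "H.hnorm (emb x) = nrm x"
  by (simp add: H.hnorm_def nrm_def hinner_emb)

lemma emb_dense:
  assumes "h \<in> hcarrier H"
  shows "\<exists>s. (\<lambda>n. H.hnorm (emb (s n) - h)) \<longlonglongrightarrow> 0"
proof -
  interpret M: Metric_space "hcarrier H" "hdist H" by (rule H.Metric_space_hdist)
  have "h \<in> M.mtopology closure_of (range emb)"
    using aux assms by (simp add: hilbert_completion_def emb_def image_image)
  then obtain k where "range k \<subseteq> range emb \<inter> hcarrier H" and k: "limitin M.mtopology k h sequentially"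
    unfolding M.closure_of_sequentially by auto
  then have "\<forall>n. \<exists>x. k n = emb x" by blast
  then obtain s where s: "\<And>n. k n = emb (s n)" by metis
  have "(\<lambda>n. hdist H (k n) h) \<longlonglongrightarrow> 0"
    using k by (simp add: M.limitin_metric_dist_null)
  then show ?thesis using assms by (auto simp: s H.hdist_eq_hnorm)
qed

lemma Cauchy_emb:
  assumes "(\<lambda>n. H.hnorm (emb (s n) - h)) \<longlonglongrightarrow> 0" "h \<in> hcarrier H" "e > 0"
  shows "\<exists>N. \<forall>m\<ge>N. \<forall>n\<ge>N. nrm (s m - s n) < e"
proof -
  obtain N where N: "\<And>n. n \<ge> N \<Longrightarrow> H.hnorm (emb (s n) - h) < e/2"
    using LIMSEQ_D[OF assms(1), of "e/2"] assms(2,3) by auto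
  have "nrm (s m - s n) < e" if "m \<ge> N" "n \<ge> N" for m n
  proof -
    have "H.hnorm (emb (s m) - emb (s n)) \<le> H.hnorm (emb (s m) - h) + H.hnorm (emb (s n) - h)"
      using H.hnorm_triangle[of "emb (s m) - h" "h - emb (s n)"] assms(2)
      by (simp add: H.hnorm_commute[of h])
    then show ?thesis using N[of m] N[of n] that by (simp flip: hnorm_emb add: emb_diff)
  qed
  then show ?thesis by blast
qed

text \<open>If \<open>emb (s n)\<close> converges to \<open>h\<close>, then \<open>s\<close> is
  Cauchy for \<open>nrm\<close>, and weak-* sequential completeness gives \<open>A (s n)\<close> a
  weak limit in \<open>F\<close>. This limit is the value that \<open>J\<close> has to take at
  \<open>h\<close>.\<close>

lemma representing_element:
  assumes h: "h \<in> hcarrier H"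
  shows "\<exists>f. \<forall>x. pair f x = hinner H h (emb x)"
proof -
  obtain s where s: "(\<lambda>n. H.hnorm (emb (s n) - h)) \<longlonglongrightarrow> 0" using emb_dense[OF h] by blast
  obtain f where "approx s f" using approx_exists[OF Cauchy_emb[OF s h]] by blast
  then have "(\<lambda>n. q (s n) x) \<longlonglongrightarrow> pair f x" for x by (simp add: approx_def)
  moreover have "(\<lambda>n. q (s n) x) \<longlonglongrightarrow> hinner H h (emb x)" for x
    using H.tendsto_hinner[OF _ h _ s, of "emb x"] by (simp add: hinner_emb)
  ultimately show ?thesis by (meson LIMSEQ_unique)
qed

text \<open>The right-hand side defines a weakly continuous extension of the inclusion. It is the
  only one, since the embedded range is dense and weak continuity determines the values at
  limits.\<close>

lemma pair_J_op:
  assumes "h \<in> hcarrier H"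
  shows "pair (J_op scaleF pair A H \<iota> h) x = hinner H h (emb x)"
proof -
  \<comment> \<open>The restriction fixes the values off the carrier, as membership in
    \<open>extensional\<close> demands; this is what makes the description in \<open>J_op\<close>
    unique.\<close>
  define J where "J = restrict (\<lambda>h. SOME f. \<forall>x. pair f x = hinner H h (emb x)) (hcarrier H)"
  have J: "pair (J h) x = hinner H h (emb x)" if "h \<in> hcarrier H" for h x
    using someI_ex[OF representing_element[OF that]] that by (simp add: J_def)
  have lin: "linear_on (hcarrier H) (hscale H) scaleF J"
    unfolding linear_on_def
    by (auto intro!: F_eqI simp: J pair_add_left pair_scale_left H.hinner_simps)
  have ext: "J \<in> extensional (hcarrier H)" by (simp add: J_def)
  have "continuous_map (hweak_topology H) euclidean (\<lambda>h. pair (J h) x)" for x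
    by (rule continuous_map_eq[OF continuous_map_weak_topology_component[of "emb x"]])
      (simp_all add: J)
  then have cont: "continuous_map (hweak_topology H) (sigma_FE pair) J"
    by (intro continuous_map_into_weak_topology) simp_all
  have J_range: "J (\<iota> f) = f" if "f \<in> range A" for f
    using that by (auto intro!: F_eqI simp: J hinner_emb q_def simp flip: emb_def)
  have "J_op scaleF pair A H \<iota> = J"
    unfolding J_op_def
  proof (rule the_equality)
    fix J'
    assume J': "J' \<in> extensional (hcarrier H) \<and> linear_on (hcarrier H) (hscale H) scaleF J' \<and>
      continuous_map (hweak_topology H) (sigma_FE pair) J' \<and> (\<forall>f\<in>range A. J' (\<iota> f) = f)"
    show "J' = J"
    proof (rule extensionalityI)
      fix h assume h: "h \<in> hcarrier H"
      obtain s where s: "(\<lambda>n. H.hnorm (emb (s n) - h)) \<longlonglongrightarrow> 0" using emb_dense[OF h] by blast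
      show "J' h = J h"
      proof (rule F_eqI)
        fix x
        have "continuous_map (sigma_FE pair) euclidean (\<lambda>f. pair f x)"
          by (rule continuous_map_weak_topology_component) simp
        with J' have "continuous_map (hweak_topology H) euclidean ((\<lambda>f. pair f x) \<circ> J')"
          using continuous_map_compose by blast
        \<comment> \<open>Norm convergence implies weak convergence, so the merely weakly continuous
          \<open>J'\<close> may be evaluated along the approximating sequence.\<close>
        moreover have "limitin (hweak_topology H) (\<lambda>n. emb (s n)) h sequentially"
          using h by (intro limitin_weak_topology H.tendsto_hinner s) simp_all
        ultimately have "limitin euclidean (((\<lambda>f. pair f x) \<circ> J') \<circ> (\<lambda>n. emb (s n)))
            (((\<lambda>f. pair f x) \<circ> J') h) sequentially"
          by (rule continuous_map_limit)
        then have "(\<lambda>n. pair (J' (\<iota> (A (s n)))) x) \<longlonglongrightarrow> pair (J' h) x"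
          by (simp add: o_def emb_def)
        then have "(\<lambda>n. q (s n) x) \<longlonglongrightarrow> pair (J' h) x" using J' by (simp add: q_def)
        moreover have "(\<lambda>n. q (s n) x) \<longlonglongrightarrow> hinner H h (emb x)"
          using H.tendsto_hinner[OF _ h _ s, of "emb x"] by (simp add: hinner_emb)
        ultimately show "pair (J' h) x = pair (J h) x" using J[OF h] LIMSEQ_unique by metis
      qed
    qed (use J' ext in auto)
  qed (use lin ext cont J_range in auto)
  then show ?thesis using J[OF assms] by simp
qed

text \<open>Any candidate \<open>k\<close> has the same inner products as \<open>emb x\<close> with
  every \<open>h\<close>; testing with \<open>h = k - emb x\<close> forces equality.\<close>

lemma adjoint_J_op: "adjoint_op pair H (J_op scaleF pair A H \<iota>) x = emb x"
  unfolding adjoint_op_def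
proof (rule the_equality)
  fix k assume k: "k \<in> hcarrier H \<and>
    (\<forall>h\<in>hcarrier H. pair (J_op scaleF pair A H \<iota> h) x = hinner H h k)"
  then have "hinner H (k - emb x) (k - emb x) = 0"
    using pair_J_op[of "k - emb x" x] H.hinner_diff_right[of k "emb x" "k - emb x"] by simp
  then show "k = emb x" using H.hinner_definite[of "k - emb x"] k by simp
qed (simp add: pair_J_op)

end

section \<open>Existence of the parallel sum\<close>

locale two_positive_operators =
  A: positive_operator scaleE scaleF pair A + B: positive_operator scaleE scaleF pair B
  for scaleE :: "complex \<Rightarrow> 'e::ab_group_add \<Rightarrow> 'e"
    and scaleF :: "complex \<Rightarrow> 'f::ab_group_add \<Rightarrow> 'f"
    and pair :: "'f \<Rightarrow> 'e \<Rightarrow> complex" and A B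
begin

text \<open>With \<open>c = 1\<close> this is the expression minimized for \<open>A:B\<close>, with
  \<open>c = n\<close> the one for \<open>(nA):B\<close>. Keeping the weight outside the operator
  makes the energies of all \<open>n\<close> comparable.\<close>

definition energy :: "real \<Rightarrow> 'e \<Rightarrow> 'e \<Rightarrow> real"
  where "energy c x y = c * (A.nrm (x - y))\<^sup>2 + (B.nrm y)\<^sup>2"

definition min_energy :: "real \<Rightarrow> 'e \<Rightarrow> real"
  where "min_energy c x = (INF y. energy c x y)"

lemma energy_nonneg: "0 \<le> c \<Longrightarrow> 0 \<le> energy c x y"
  by (simp add: energy_def)

lemma min_energy_le: "0 \<le> c \<Longrightarrow> min_energy c x \<le> energy c x y"
  unfolding min_energy_def by (rule cINF_lower) (auto intro: energy_nonneg bdd_belowI[of _ 0])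

lemma min_energy_greatest: "(\<And>y. d \<le> energy c x y) \<Longrightarrow> d \<le> min_energy c x"
  unfolding min_energy_def by (rule cINF_greatest) auto

lemma min_energy_le_nrm: "0 \<le> c \<Longrightarrow> min_energy c x \<le> (B.nrm x)\<^sup>2"
  using min_energy_le[of c x x] by (simp add: energy_def A.nrm_def A.q_simps)

lemma energy_mono: "c \<le> d \<Longrightarrow> energy c x y \<le> energy d x y"
  by (simp add: energy_def mult_right_mono)

lemma min_energy_mono: "\<lbrakk>0 \<le> c; c \<le> d\<rbrakk> \<Longrightarrow> min_energy c x \<le> min_energy d x"
  by (meson energy_mono min_energy_greatest min_energy_le order_trans)

lemma near_minimizer: assumes "e > 0" shows "\<exists>y. energy c x y < min_energy c x + e"
proof (rule ccontr)
  assume "\<nexists>y. energy c x y < min_energy c x + e"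
  then have "min_energy c x + e \<le> min_energy c x"
    by (intro min_energy_greatest) (simp add: not_less)
  with assms show False by simp
qed

text \<open>The parallelogram law for both squared seminorms. In the difference of
  \<open>x - y\<close> and \<open>x - z\<close> the vector \<open>x\<close> cancels, so the deficit
  depends on \<open>y - z\<close> alone.\<close>

lemma energy_midpoint:
  "energy c x (scaleE (1/2) (y + z)) = energy c x y / 2 + energy c x z / 2
    - (c * (A.nrm (y - z))\<^sup>2 + (B.nrm (y - z))\<^sup>2) / 4"
proof -
  have "scaleE (1/2) x + scaleE (1/2) x = x"
    by (simp flip: A.E.scale_left_distrib)
  then have "x - scaleE (1/2) (y + z) = scaleE (1/2) ((x - y) + (x - z))"
    by (simp add: A.E.scale_right_distrib A.E.scale_right_diff_distrib algebra_simps)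
  then have "energy c x (scaleE (1/2) (y + z))
      = c * (A.nrm (scaleE (1/2) ((x - y) + (x - z))))\<^sup>2 + (B.nrm (scaleE (1/2) (y + z)))\<^sup>2"
    by (simp only: energy_def)
  then show ?thesis
    unfolding A.nrm_midpoint_power2 B.nrm_midpoint_power2
    by (simp add: energy_def A.nrm_minus[of z y] algebra_simps add_divide_distrib diff_divide_distrib)
qed

text \<open>The midpoint of \<open>y\<close> and \<open>z\<close> competes in the infimum for the
  weight \<open>c\<close>, and the energy of \<open>z\<close> for \<open>c\<close> is at most its
  energy for \<open>d\<close>. Inserting both bounds into \<open>energy_midpoint\<close> leaves only
  the gap and the two slacks.\<close>

lemma near_minimizers_close:
  assumes c: "0 \<le> c" "c \<le> d"
    and y: "energy c x y \<le> min_energy c x + \<delta>" and z: "energy d x z \<le> min_energy d x + \<epsilon>"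
  shows "c * (A.nrm (y - z))\<^sup>2 + (B.nrm (y - z))\<^sup>2
    \<le> 2 * (min_energy d x - min_energy c x) + 2 * \<delta> + 2 * \<epsilon>"
  using min_energy_le[OF c(1), of x "scaleE (1/2) (y + z)"] y z energy_mono[OF c(2), of x z]
  unfolding energy_midpoint by argo

text \<open>The minimal energies increase and are bounded by the energy of \<open>y = x\<close>, so
  their gaps tend to 0. Constant weights serve the existence of \<open>A:B\<close>, the weights
  \<open>n\<close> its limit.\<close>

lemma near_minimizers_Cauchy:
  assumes c: "mono c" "\<And>n. 0 \<le> c n"
    and y: "\<And>n. energy (c n) x (y n) \<le> min_energy (c n) x + inverse (Suc n)" and e: "e > 0"
  shows "\<exists>N. \<forall>n\<ge>N. \<forall>m\<ge>n. c n * (A.nrm (y n - y m))\<^sup>2 + (B.nrm (y n - y m))\<^sup>2 < e"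
proof -
  let ?\<phi> = "\<lambda>n. min_energy (c n) x"
  have "incseq ?\<phi>" using c by (auto simp: incseq_def mono_def intro: min_energy_mono)
  then have "convergent ?\<phi>"
    using incseq_convergent[of ?\<phi> "(B.nrm x)\<^sup>2"] min_energy_le_nrm c(2) by (metis convergentI)
  \<comment> \<open>The bound of \<open>near_minimizers_close\<close> is twice the sum of one gap
    and two slacks; making each less than \<open>e/6\<close> gives \<open>e\<close>.\<close>
  then obtain N where N: "\<And>m n. m \<ge> N \<Longrightarrow> n \<ge> N \<Longrightarrow> \<bar>?\<phi> m - ?\<phi> n\<bar> < e/6"
    using CauchyD[OF convergent_Cauchy, of ?\<phi> "e/6"] e by (auto simp: real_norm_def)
  obtain K where K: "inverse (real (Suc K)) < e/6" using reals_Archimedean[of "e/6"] e by auto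
  have "c n * (A.nrm (y n - y m))\<^sup>2 + (B.nrm (y n - y m))\<^sup>2 < e" if "n \<ge> max N K" "m \<ge> n" for n m
  proof -
    have "inverse (real (Suc n)) \<le> inverse (real (Suc K))" "inverse (real (Suc m)) \<le> inverse (real (Suc K))"
      using that by (auto intro!: le_imp_inverse_le)
    moreover have "?\<phi> m - ?\<phi> n < e/6" using le_less_trans[OF abs_ge_self N[of m n]] that by simp
    ultimately show ?thesis
      using near_minimizers_close[OF c(2)[of n] monoD[OF c(1) that(2)] y[of n] y[of m]] K
      by argo
  qed
  then show ?thesis by blast
qed

section \<open>First variation of the energy\<close>

lemma energy_shift:
  "energy 1 x (y - w) = energy 1 x y + 2 * Re (A.q (x - y) w - B.q y w)
    + (A.nrm w)\<^sup>2 + (B.nrm w)\<^sup>2"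
proof -
  have "x - (y - w) = (x - y) + w" by simp
  moreover have "(B.nrm (y - w))\<^sup>2 = (B.nrm y)\<^sup>2 - 2 * Re (B.q y w) + (B.nrm w)\<^sup>2"
    using B.q_herm[of y w] by (simp add: B.nrm_power2 B.q_simps)
  ultimately show ?thesis by (simp only: energy_def A.nrm_add_power2) simp
qed

text \<open>The exact minimizer would satisfy the Euler equation \<open>A (x - y) = B y\<close>. A
  near-minimizer satisfies it approximately, because a move along \<open>w\<close> can lower the
  energy by at most \<epsilon>.\<close>

lemma near_minimizer_variation:
  assumes y: "energy 1 x y \<le> min_energy 1 x + \<epsilon>"
  shows "(cmod (A.q (x - y) w - B.q y w))\<^sup>2 \<le> \<epsilon> * ((A.nrm w)\<^sup>2 + (B.nrm w)\<^sup>2 + 1)"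
proof -
  define D where "D = A.q (x - y) w - B.q y w"
  define S where "S = (A.nrm w)\<^sup>2 + (B.nrm w)\<^sup>2"
  \<comment> \<open>The phase of \<open>D\<close> makes the linear term real and negative. The best
    length would come from dividing by \<open>S\<close>; dividing by \<open>S + 1\<close> stays
    meaningful when both seminorms of \<open>w\<close> vanish.\<close>
  define l where "l = - D / of_real (S + 1)"
  have S: "S \<ge> 0" by (simp add: S_def)
  have l: "cnj l * D = - of_real ((cmod D)\<^sup>2 / (S + 1))" "(cmod l)\<^sup>2 = (cmod D)\<^sup>2 / (S + 1)\<^sup>2"
    using S complex_norm_square[of D]
    by (simp_all add: l_def norm_divide power_divide mult.commute del: of_real_add)
  have "min_energy 1 x \<le> energy 1 x (y - scaleE l w)" by (simp add: min_energy_le)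
  also have "\<dots> = energy 1 x y + 2 * Re (cnj l * D) + (cmod l)\<^sup>2 * S"
    by (simp add: energy_shift A.q_simps B.q_simps A.nrm_scale B.nrm_scale D_def S_def
        power_mult_distrib algebra_simps)
  also have "\<dots> \<le> min_energy 1 x + \<epsilon> - 2 * ((cmod D)\<^sup>2 / (S + 1)) + (cmod D)\<^sup>2 / (S + 1)\<^sup>2 * S"
    using y unfolding l by simp
  finally have "2 * ((cmod D)\<^sup>2 / (S + 1)) - (cmod D)\<^sup>2 / (S + 1) * (S / (S + 1)) \<le> \<epsilon>"
    by (simp add: power2_eq_square)
  moreover have "(cmod D)\<^sup>2 / (S + 1) * (S / (S + 1)) \<le> (cmod D)\<^sup>2 / (S + 1) * 1"
    using S by (intro mult_left_mono) auto
  ultimately have "(cmod D)\<^sup>2 / (S + 1) \<le> \<epsilon>" by simp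
  then have "(cmod D)\<^sup>2 \<le> \<epsilon> * (S + 1)" using S by (subst (asm) pos_divide_le_eq) auto
  then show ?thesis by (simp only: D_def S_def)
qed

text \<open>The decomposition of \<open>x\<close> that is optimal in the infimum defining \<open>A:B\<close> need not exist in \<open>E\<close>,
  but the common value \<open>f = A s = B t\<close> that an optimal \<open>x = s + t\<close> would have exists as a limit.\<close>

definition parallel_value :: "'e \<Rightarrow> 'f \<Rightarrow> bool"
  where "parallel_value x f \<longleftrightarrow> (\<exists>s t. A.approx s f \<and> B.approx t f \<and> (\<forall>n. s n + t n = x))"

lemma parallel_valueE:
  assumes "parallel_value x f"
  obtains s t where "A.approx s f" "B.approx t f" "\<And>n. s n + t n = x"
  using assms by (auto simp: parallel_value_def)

lemma parallel_value_add:
  assumes "parallel_value x f" "parallel_value y g" shows "parallel_value (x + y) (f + g)"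
proof -
  obtain s t where st: "A.approx s f" "B.approx t f" "\<And>n. s n + t n = x"
    using assms(1) by (rule parallel_valueE) blast
  obtain s' t' where st': "A.approx s' g" "B.approx t' g" "\<And>n. s' n + t' n = y"
    using assms(2) by (rule parallel_valueE) blast
  have "(s n + s' n) + (t n + t' n) = x + y" for n
    using st(3)[of n] st'(3)[of n] by (metis add.assoc add.left_commute)
  with A.approx_add[OF st(1) st'(1)] B.approx_add[OF st(2) st'(2)]
  show ?thesis unfolding parallel_value_def by blast
qed

lemma parallel_value_scale:
  assumes "parallel_value x f" shows "parallel_value (scaleE c x) (scaleF c f)"
proof -
  obtain s t where st: "A.approx s f" "B.approx t f" "\<And>n. s n + t n = x"
    using assms by (rule parallel_valueE) blast
  have "scaleE c (s n) + scaleE c (t n) = scaleE c x" for n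
    using st(3)[of n] by (simp flip: A.E.scale_right_distrib)
  with A.approx_scale[OF st(1)] B.approx_scale[OF st(2)]
  show ?thesis unfolding parallel_value_def by blast
qed

text \<open>Split \<open>y\<close> into \<open>s' n + t' n\<close> and replace \<open>f\<close> by
  \<open>A (s n)\<close> on the first part and by \<open>B (t n)\<close> on the second; both errors
  vanish by \<open>approx_pair_q\<close>. The resulting expression treats the two decompositions
  alike, which gives Hermitian symmetry, and for equal decompositions it is the energy.\<close>

lemma parallel_value_pairing:
  assumes "A.approx s f" "B.approx t f" "A.approx s' g" "B.approx t' g" "\<And>n. s' n + t' n = y"
  shows "(\<lambda>n. A.q (s n) (s' n) + B.q (t n) (t' n)) \<longlonglongrightarrow> pair f y"
proof -
  have "(\<lambda>n. (pair f (s' n) - A.q (s n) (s' n)) + (pair f (t' n) - B.q (t n) (t' n))) \<longlonglongrightarrow> 0 + 0"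
    by (intro tendsto_add A.approx_pair_q[OF assms(1,3)] B.approx_pair_q[OF assms(2,4)])
  moreover have "pair f y = pair f (s' n) + pair f (t' n)" for n
    using assms(5)[of n] by (metis A.pair_add_right)
  ultimately have "(\<lambda>n. pair f y - (A.q (s n) (s' n) + B.q (t n) (t' n))) \<longlonglongrightarrow> 0"
    by (simp add: algebra_simps)
  from tendsto_diff[OF tendsto_const[of "pair f y"] this] show ?thesis by simp
qed

lemma parallel_value_herm:
  assumes "parallel_value x f" "parallel_value y g"
  shows "pair g x = cnj (pair f y)"
proof -
  obtain s t where st: "A.approx s f" "B.approx t f" "\<And>n. s n + t n = x"
    using assms(1) by (rule parallel_valueE) blast
  obtain s' t' where st': "A.approx s' g" "B.approx t' g" "\<And>n. s' n + t' n = y"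
    using assms(2) by (rule parallel_valueE) blast
  have "(\<lambda>n. cnj (A.q (s n) (s' n) + B.q (t n) (t' n))) \<longlonglongrightarrow> cnj (pair f y)"
    by (rule tendsto_cnj[OF parallel_value_pairing[OF st(1,2) st']])
  moreover have "(\<lambda>n. A.q (s' n) (s n) + B.q (t' n) (t n)) \<longlonglongrightarrow> pair g x"
    by (rule parallel_value_pairing[OF st'(1,2) st])
  ultimately show ?thesis
    by (simp add: LIMSEQ_unique flip: A.q_herm B.q_herm)
qed

text \<open>The energies of \<open>t n\<close> tend to \<open>pair f x\<close>, which is therefore
  no less than the infimum. It is also no greater: \<open>A (s n)\<close> and \<open>B (t n)\<close>
  have the same limit \<open>f\<close>, so the first variation towards any competitor
  \<open>y\<close> vanishes in the limit.\<close>

lemma parallel_value_quadratic: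
  assumes "parallel_value x f"
  shows "pair f x = of_real (min_energy 1 x)"
proof -
  obtain s t where st: "A.approx s f" "B.approx t f" "\<And>n. s n + t n = x"
    using assms by (rule parallel_valueE) blast
  have s: "x - t n = s n" for n using st(3)[of n] by (metis add_diff_cancel_right')
  have "(\<lambda>n. complex_of_real (energy 1 x (t n))) \<longlonglongrightarrow> pair f x"
    using parallel_value_pairing[OF st(1,2) st]
    by (simp add: A.q_self B.q_self energy_def s del: of_real_power)
  from tendsto_Re[OF this] tendsto_Im[OF this]
  have lim: "(\<lambda>n. energy 1 x (t n)) \<longlonglongrightarrow> Re (pair f x)" and Im: "Im (pair f x) = 0"
    by (simp_all add: LIMSEQ_const_iff)
  have "Re (pair f x) \<le> energy 1 x y" for y
  proof (rule LIMSEQ_le_const2)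
    \<comment> \<open>Chosen so that \<open>t n - ?w n = y\<close>. As \<open>?w\<close> is
      approximating for both forms, \<open>approx_pair_q\<close> applies to each half of the linear
      term.\<close>
    let ?w = "\<lambda>n. t n - y"
    have w: "?w n = (x - y) - s n" for n by (simp flip: s)
    have "A.approx ?w (A (x - y) - f)"
      unfolding w by (intro A.approx_diff A.approx_range st)
    moreover have "B.approx ?w (f - B y)" by (intro B.approx_diff B.approx_range st)
    ultimately have "(\<lambda>n. (pair f (?w n) - B.q (t n) (?w n)) - (pair f (?w n) - A.q (s n) (?w n)))
        \<longlonglongrightarrow> 0 - 0"
      using A.approx_pair_q[OF st(1)] B.approx_pair_q[OF st(2)] by (intro tendsto_diff)
    then have "(\<lambda>n. A.q (s n) (?w n) - B.q (t n) (?w n)) \<longlonglongrightarrow> 0" by simp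
    from tendsto_add[OF lim tendsto_mult_left[OF tendsto_Re[OF this], of 2]]
    show "(\<lambda>n. energy 1 x (t n) + 2 * Re (A.q (s n) (?w n) - B.q (t n) (?w n))) \<longlonglongrightarrow> Re (pair f x)"
      by simp
    have "energy 1 x (t n) + 2 * Re (A.q (s n) (?w n) - B.q (t n) (?w n)) \<le> energy 1 x y" for n
      using energy_shift[of x "t n" "?w n"] by (simp add: s)
    then show "\<exists>N. \<forall>n\<ge>N. energy 1 x (t n) + 2 * Re (A.q (s n) (?w n) - B.q (t n) (?w n)) \<le> energy 1 x y"
      by blast
  qed
  then have "Re (pair f x) \<le> min_energy 1 x" by (rule min_energy_greatest)
  moreover have "min_energy 1 x \<le> Re (pair f x)"
    by (rule LIMSEQ_le_const[OF lim]) (simp add: min_energy_le)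
  ultimately show ?thesis using Im by (simp add: complex_eq_iff)
qed

text \<open>Near-minimizers \<open>t n\<close> are Cauchy for both seminorms, so
  \<open>A (x - t n)\<close> and \<open>B (t n)\<close> have weak limits. The Euler equation, valid
  up to a vanishing error, makes the two limits equal.\<close>

lemma parallel_value_exists: "\<exists>f. parallel_value x f"
proof -
  have "\<exists>y. energy 1 x y < min_energy 1 x + inverse (Suc n)" for n
    by (rule near_minimizer) simp
  then obtain t where "\<And>n. energy 1 x (t n) < min_energy 1 x + inverse (Suc n)" by metis
  then have t: "energy 1 x (t n) \<le> min_energy 1 x + inverse (Suc n)" for n by (meson less_imp_le)
  have close: "\<exists>N. \<forall>n\<ge>N. \<forall>m\<ge>N. (A.nrm (t n - t m))\<^sup>2 + (B.nrm (t n - t m))\<^sup>2 < e\<^sup>2"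
    if "e > 0" for e :: real
  proof -
    have "0 < e\<^sup>2" using that by simp
    then obtain N where N: "\<And>n m. n \<ge> N \<Longrightarrow> m \<ge> n \<Longrightarrow> (A.nrm (t n - t m))\<^sup>2 + (B.nrm (t n - t m))\<^sup>2 < e\<^sup>2"
      using near_minimizers_Cauchy[of "\<lambda>_. 1" x t "e\<^sup>2"] t by (auto simp: mono_def)
    have "(A.nrm (t n - t m))\<^sup>2 + (B.nrm (t n - t m))\<^sup>2 < e\<^sup>2" if "n \<ge> N" "m \<ge> N" for n m
      using N[of n m] N[of m n] that A.nrm_minus[of "t n"] B.nrm_minus[of "t n"]
      by (cases "n \<le> m") auto
    then show ?thesis by blast
  qed
  have small: "a < e" if "a\<^sup>2 + b\<^sup>2 < e\<^sup>2" "e > 0" for a b e :: real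
  proof (rule power_less_imp_less_base)
    show "a\<^sup>2 < e\<^sup>2" using that(1) zero_le_power2[of b] by linarith
  qed (use that in simp)
  have "\<exists>g. A.approx (\<lambda>n. x - t n) g"
  proof (rule A.approx_exists)
    fix e :: real assume e: "e > 0"
    from close[OF e] small[OF _ e] show "\<exists>N. \<forall>m\<ge>N. \<forall>n\<ge>N. A.nrm ((x - t m) - (x - t n)) < e"
      by (simp add: A.nrm_minus) blast
  qed
  then obtain g where g: "A.approx (\<lambda>n. x - t n) g" by blast
  have "\<exists>f. B.approx t f"
  proof (rule B.approx_exists)
    fix e :: real assume e: "e > 0"
    from close[OF e] small[OF _ e] show "\<exists>N. \<forall>m\<ge>N. \<forall>n\<ge>N. B.nrm (t m - t n) < e"
      by (metis add.commute)
  qed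
  then obtain f where f: "B.approx t f" by blast
  have "g = f"
  proof (rule A.F_eqI)
    fix w
    let ?D = "\<lambda>n. A.q (x - t n) w - B.q (t n) w"
    let ?S = "(A.nrm w)\<^sup>2 + (B.nrm w)\<^sup>2 + 1"
    have "(\<lambda>n. (cmod (?D n))\<^sup>2) \<longlonglongrightarrow> 0"
    proof (rule Lim_null_comparison)
      show "\<forall>\<^sub>F n in sequentially. norm ((cmod (?D n))\<^sup>2) \<le> inverse (real (Suc n)) * ?S"
        using near_minimizer_variation[OF t] by simp
      show "(\<lambda>n. inverse (real (Suc n)) * ?S) \<longlonglongrightarrow> 0"
        using tendsto_mult_right[OF LIMSEQ_inverse_real_of_nat, of ?S] by simp
    qed
    then have "?D \<longlonglongrightarrow> 0" by (simp add: tendsto_norm_zero_iff)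
    moreover have "?D \<longlonglongrightarrow> pair g w - pair f w"
      using f g by (intro tendsto_diff) (auto simp: A.approx_def B.approx_def)
    ultimately show "pair g w = pair f w" using LIMSEQ_unique by fastforce
  qed
  then show ?thesis using f g unfolding parallel_value_def by force
qed

text \<open>By Hermitian symmetry \<open>pair f y\<close> is the conjugate of
  \<open>pair g x\<close> for any value \<open>g\<close> of \<open>y\<close>, which does not involve
  \<open>f\<close>. Uniqueness turns the sum and scaling rules for values into linearity of the
  chosen operator.\<close>

lemma parallel_value_unique:
  assumes "parallel_value x f" "parallel_value x f'" shows "f = f'"
proof (rule A.F_eqI)
  fix y
  obtain g where "parallel_value y g" using parallel_value_exists by blast
  then show "pair f y = pair f' y"
    using parallel_value_herm[OF assms(1)] parallel_value_herm[OF assms(2)] by (metis complex_cnj_cnj)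
qed

section \<open>The parallel sum as an operator\<close>

lemma parallel_sum_exists:
  "\<exists>C. positive_op scaleE scaleF pair C \<and> (\<forall>x. pair (C x) x = of_real (min_energy 1 x))"
proof -
  obtain C where C: "\<And>x. parallel_value x (C x)" using parallel_value_exists by metis
  have "Vector_Spaces.linear scaleE scaleF C"
    using A.E.vector_space_axioms A.F.vector_space_axioms parallel_value_unique C
      parallel_value_add parallel_value_scale
    unfolding Vector_Spaces.linear_iff by metis
  moreover have "0 \<le> min_energy 1 x" for x
    by (rule min_energy_greatest) (simp add: energy_nonneg)
  ultimately show ?thesis
    using parallel_value_quadratic[OF C] by (auto simp: positive_op_def)
qed

lemma parallel_sum_props:
  shows parallel_sum_positive: "positive_op scaleE scaleF pair (parallel_sum scaleE scaleF pair A B)"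
    and parallel_sum_quadratic:
      "pair (parallel_sum scaleE scaleF pair A B x) x = of_real (min_energy 1 x)"
proof -
  let ?P = "\<lambda>C. C \<in> weak_ops scaleE scaleF pair \<and> positive_op scaleE scaleF pair C \<and>
      (\<forall>x. pair (C x) x =
        complex_of_real (INF y. Re (pair (A (x - y)) (x - y)) + Re (pair (B y) y)))"
  have E: "(INF y. Re (pair (A (x - y)) (x - y)) + Re (pair (B y) y)) = min_energy 1 x" for x
    by (simp add: min_energy_def energy_def A.nrm_power2 B.nrm_power2 A.q_def B.q_def)
  obtain C where C: "positive_op scaleE scaleF pair C" "\<And>x. pair (C x) x = of_real (min_energy 1 x)"
    using parallel_sum_exists by blast
  interpret C: positive_operator scaleE scaleF pair C
    by unfold_locales (use A.seq_complete C in auto)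
  have "?P C" using C C.A_weak_op E by simp
  moreover have "C' = C" if "?P C'" for C'
    using that C by (intro C.positive_op_eqI) (auto simp: E)
  ultimately have "parallel_sum scaleE scaleF pair A B = C"
    unfolding parallel_sum_def by (rule the_equality)
  then show "positive_op scaleE scaleF pair (parallel_sum scaleE scaleF pair A B)"
    "pair (parallel_sum scaleE scaleF pair A B x) x = of_real (min_energy 1 x)"
    using C by auto
qed

end

section \<open>The limit of the parallel sums\<close>

locale two_aux_spaces = two_positive_operators scaleE scaleF pair A B +
  A: aux_space scaleE scaleF pair A HA \<iota>A + B: aux_space scaleE scaleF pair B HB \<iota>B
  for scaleE :: "complex \<Rightarrow> 'e::ab_group_add \<Rightarrow> 'e"
    and scaleF :: "complex \<Rightarrow> 'f::ab_group_add \<Rightarrow> 'f"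
    and pair :: "'f \<Rightarrow> 'e \<Rightarrow> complex" and A B
    and HA :: "'h::ab_group_add hilbert" and \<iota>A :: "'f \<Rightarrow> 'h"
    and HB :: "'k::ab_group_add hilbert" and \<iota>B :: "'f \<Rightarrow> 'k"
begin

section \<open>The multivalued part in terms of sequences\<close>

abbreviation "M \<equiv> multivalued_part A B HA \<iota>A HB \<iota>B"

text \<open>Both factors are metric, so a point of the closure is reached by picking a graph element
  in the product of balls of radius \<open>inverse (Suc n)\<close>. The preimages \<open>z n\<close>
  in \<open>E\<close> are what the energy estimates can use.\<close>

lemma multivalued_part_iff:
  "\<xi> \<in> M \<longleftrightarrow> \<xi> \<in> hcarrier HB \<and>
    (\<exists>z. (\<lambda>n. A.nrm (z n)) \<longlonglongrightarrow> 0 \<and> (\<lambda>n. B.H.hnorm (B.emb (z n) - \<xi>)) \<longlonglongrightarrow> 0)"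
proof -
  interpret MA: Metric_space "hcarrier HA" "hdist HA" by (rule A.H.Metric_space_hdist)
  interpret MB: Metric_space "hcarrier HB" "hdist HB" by (rule B.H.Metric_space_hdist)
  let ?X = "prod_topology MA.mtopology MB.mtopology"
  let ?R = "range (\<lambda>x. (A.emb x, B.emb x))"
  have A0: "hdist HA (A.emb x) 0 = A.nrm x" for x
    by (simp add: A.H.hdist_eq_hnorm A.hnorm_emb)
  then have A0': "hdist HA 0 (A.emb x) = A.nrm x" for x
    by (simp add: MA.commute[of 0 "A.emb x"])
  have "(0, \<xi>) \<in> ?X closure_of ?R \<longleftrightarrow>
    (\<exists>z. (\<lambda>n. A.nrm (z n)) \<longlonglongrightarrow> 0 \<and> (\<lambda>n. B.H.hnorm (B.emb (z n) - \<xi>)) \<longlonglongrightarrow> 0)"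
    if \<xi>: "\<xi> \<in> hcarrier HB"
  proof
    assume cl: "(0, \<xi>) \<in> ?X closure_of ?R"
    have "\<exists>x. A.nrm x < inverse (Suc n) \<and> B.H.hnorm (B.emb x - \<xi>) < inverse (Suc n)" for n
    proof -
      let ?U = "MA.mball 0 (inverse (Suc n)) \<times> MB.mball \<xi> (inverse (Suc n))"
      have "openin ?X ?U" by (simp add: openin_prod_Times_iff)
      moreover have "(0, \<xi>) \<in> ?U" using \<xi> by simp
      ultimately have "\<exists>p. p \<in> ?R \<and> p \<in> ?U"
        using cl unfolding in_closure_of by (elim conjE allE[of _ ?U] impE) (rule conjI)
      then obtain x where "(A.emb x, B.emb x) \<in> ?U" by fast
      then have "hdist HA 0 (A.emb x) < inverse (Suc n)" "hdist HB \<xi> (B.emb x) < inverse (Suc n)"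
        by (simp_all only: mem_Sigma_iff MA.in_mball MB.in_mball)
      then show ?thesis
        unfolding A0' B.H.hdist_eq_hnorm[OF \<xi> B.emb_mem] B.H.hnorm_commute[OF \<xi> B.emb_mem] by blast
    qed
    then obtain z where z: "\<And>n. A.nrm (z n) < inverse (Suc n)"
        "\<And>n. B.H.hnorm (B.emb (z n) - \<xi>) < inverse (Suc n)" by metis
    have "(\<lambda>n. A.nrm (z n)) \<longlonglongrightarrow> 0"
      by (rule Lim_null_comparison[OF _ LIMSEQ_inverse_real_of_nat])
        (simp add: less_imp_le[OF z(1)] del: of_nat_Suc)
    moreover have "(\<lambda>n. B.H.hnorm (B.emb (z n) - \<xi>)) \<longlonglongrightarrow> 0"
      by (rule Lim_null_comparison[OF _ LIMSEQ_inverse_real_of_nat])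
        (simp add: less_imp_le[OF z(2)] \<xi> del: of_nat_Suc)
    ultimately show "\<exists>z. (\<lambda>n. A.nrm (z n)) \<longlonglongrightarrow> 0 \<and> (\<lambda>n. B.H.hnorm (B.emb (z n) - \<xi>)) \<longlonglongrightarrow> 0"
      by blast
  next
    assume "\<exists>z. (\<lambda>n. A.nrm (z n)) \<longlonglongrightarrow> 0 \<and> (\<lambda>n. B.H.hnorm (B.emb (z n) - \<xi>)) \<longlonglongrightarrow> 0"
    then obtain z where z: "(\<lambda>n. A.nrm (z n)) \<longlonglongrightarrow> 0" "(\<lambda>n. B.H.hnorm (B.emb (z n) - \<xi>)) \<longlonglongrightarrow> 0"
      by blast
    have "limitin MA.mtopology (\<lambda>n. A.emb (z n)) 0 sequentially"
      using z(1) by (simp add: MA.limitin_metric_dist_null A0)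
    moreover have "limitin MB.mtopology (\<lambda>n. B.emb (z n)) \<xi> sequentially"
      using z(2) \<xi> by (simp add: MB.limitin_metric_dist_null B.H.hdist_eq_hnorm)
    ultimately have lim: "limitin ?X (\<lambda>n. (A.emb (z n), B.emb (z n))) (0, \<xi>) sequentially"
      by (simp add: limitin_pairwise o_def)
    show "(0, \<xi>) \<in> ?X closure_of ?R"
      unfolding in_closure_of
    proof (intro conjI strip)
      fix U assume "(0, \<xi>) \<in> U \<and> openin ?X U"
      with lim have "\<forall>\<^sub>F n in sequentially. (A.emb (z n), B.emb (z n)) \<in> U"
        by (simp add: limitin_def)
      then obtain n where "(A.emb (z n), B.emb (z n)) \<in> U"
        using eventually_happens'[OF sequentially_bot] by blast
      then show "\<exists>y. y \<in> ?R \<and> y \<in> U" by blast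
    qed (use \<xi> in simp)
  qed
  then show ?thesis
    unfolding multivalued_part_def A.emb_def[symmetric] B.emb_def[symmetric] by blast
qed

lemma multivalued_part_subset: "M \<subseteq> hcarrier HB"
  by (auto simp: multivalued_part_def)

lemma multivalued_part_subspace: "B.H.subspace M"
  unfolding B.H.subspace_def
proof (intro conjI ballI allI)
  show "0 \<in> M"
    unfolding multivalued_part_iff by (auto intro!: exI[of _ "\<lambda>_. 0"] simp: A.nrm_def A.q_simps)
  fix \<xi> assume "\<xi> \<in> M"
  then obtain z where \<xi>: "\<xi> \<in> hcarrier HB"
    and z: "(\<lambda>n. A.nrm (z n)) \<longlonglongrightarrow> 0" "(\<lambda>n. B.H.hnorm (B.emb (z n) - \<xi>)) \<longlonglongrightarrow> 0"
    unfolding multivalued_part_iff by blast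
  {
    fix \<eta> assume "\<eta> \<in> M"
    then obtain w where \<eta>: "\<eta> \<in> hcarrier HB"
      and w: "(\<lambda>n. A.nrm (w n)) \<longlonglongrightarrow> 0" "(\<lambda>n. B.H.hnorm (B.emb (w n) - \<eta>)) \<longlonglongrightarrow> 0"
      unfolding multivalued_part_iff by blast
    have "(\<lambda>n. A.nrm (z n + w n)) \<longlonglongrightarrow> 0"
      by (rule Lim_null_comparison[OF _ tendsto_add_zero[OF z(1) w(1)]]) (simp add: A.nrm_triangle)
    moreover have "(\<lambda>n. B.H.hnorm (B.emb (z n + w n) - (\<xi> + \<eta>))) \<longlonglongrightarrow> 0"
    proof (rule Lim_null_comparison[OF _ tendsto_add_zero[OF z(2) w(2)]])
      show "\<forall>\<^sub>F n in sequentially. norm (B.H.hnorm (B.emb (z n + w n) - (\<xi> + \<eta>)))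
          \<le> B.H.hnorm (B.emb (z n) - \<xi>) + B.H.hnorm (B.emb (w n) - \<eta>)"
        using B.H.hnorm_triangle[of "B.emb (z _) - \<xi>" "B.emb (w _) - \<eta>"] \<xi> \<eta>
        by (simp add: B.emb_add add_diff_add)
    qed
    ultimately show "\<xi> + \<eta> \<in> M"
      using \<xi> \<eta> unfolding multivalued_part_iff by (auto intro!: exI[of _ "\<lambda>n. z n + w n"])
  }
  fix c
  have "(\<lambda>n. A.nrm (scaleE c (z n))) \<longlonglongrightarrow> 0"
    using tendsto_mult_left[OF z(1), of "cmod c"] by (simp add: A.nrm_scale)
  moreover have "B.H.hnorm (B.emb (scaleE c (z n)) - hscale HB c \<xi>)
      = cmod c * B.H.hnorm (B.emb (z n) - \<xi>)" for n
    using B.H.hnorm_scale[of "B.emb (z n) - \<xi>" c] \<xi>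
    by (simp add: B.emb_scale B.H.scale_right_diff_distrib)
  ultimately show "hscale HB c \<xi> \<in> M"
    using \<xi> tendsto_mult_left[OF z(2), of "cmod c"]
    unfolding multivalued_part_iff by (auto intro!: exI[of _ "\<lambda>n. scaleE c (z n)"])
qed

text \<open>Test the infimum with \<open>y = x - z n\<close>, where \<open>z\<close> is a sequence
  witnessing \<open>m\<close> in \<open>M\<close>: the penalty tends to 0 whatever the fixed weight,
  and the \<open>B\<close> part tends to the right-hand side.\<close>

lemma min_energy_le_multivalued:
  assumes "m \<in> M" "0 \<le> c"
  shows "min_energy c x \<le> (B.H.hnorm (B.emb x - m))\<^sup>2"
proof -
  obtain z where m: "m \<in> hcarrier HB"
    and z: "(\<lambda>n. A.nrm (z n)) \<longlonglongrightarrow> 0" "(\<lambda>n. B.H.hnorm (B.emb (z n) - m)) \<longlonglongrightarrow> 0"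
    using assms(1) unfolding multivalued_part_iff by blast
  have "(\<lambda>n. B.H.hnorm ((B.emb x - B.emb (z n)) - (B.emb x - m))) \<longlonglongrightarrow> 0"
    using z(2) m by (simp add: B.H.hnorm_commute[of m])
  then have "(\<lambda>n. B.H.hnorm (B.emb x - B.emb (z n))) \<longlonglongrightarrow> B.H.hnorm (B.emb x - m)"
    using m by (intro B.H.tendsto_hnorm) simp_all
  then have "(\<lambda>n. c * (A.nrm (z n))\<^sup>2 + (B.H.hnorm (B.emb x - B.emb (z n)))\<^sup>2)
      \<longlonglongrightarrow> c * 0\<^sup>2 + (B.H.hnorm (B.emb x - m))\<^sup>2"
    by (intro tendsto_intros z(1))
  then have "(\<lambda>n. energy c x (x - z n)) \<longlonglongrightarrow> (B.H.hnorm (B.emb x - m))\<^sup>2"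
    by (simp add: energy_def flip: B.emb_diff B.hnorm_emb)
  then show ?thesis
    by (rule LIMSEQ_le_const) (simp add: min_energy_le assms(2))
qed

text \<open>Near-minimizers \<open>y n\<close> for the weight \<open>n\<close> are Cauchy for \<open>B\<close>, while \<open>x - y n\<close> is forced to vanish
  for \<open>A\<close>; so \<open>B (x - y n)\<close> converges into \<open>M\<close>, and its limit is the point of \<open>M\<close> closest to \<open>B x\<close>.\<close>

lemma min_energy_limit:
  obtains \<xi> where "\<xi> \<in> M" "\<And>m. m \<in> M \<Longrightarrow> B.H.hnorm (B.emb x - \<xi>) \<le> B.H.hnorm (B.emb x - m)"
    "(\<lambda>n. min_energy (real n) x) \<longlonglongrightarrow> (B.H.hnorm (B.emb x - \<xi>))\<^sup>2"
proof -
  let ?\<phi> = "\<lambda>n. min_energy (real n) x"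
  have "\<exists>y. energy (real n) x y < ?\<phi> n + inverse (Suc n)" for n
    by (rule near_minimizer) simp
  then obtain y where "\<And>n. energy (real n) x (y n) < ?\<phi> n + inverse (Suc n)" by metis
  then have y: "energy (real n) x (y n) \<le> ?\<phi> n + inverse (Suc n)" for n by (meson less_imp_le)
  have "\<exists>N. \<forall>m\<ge>N. \<forall>n\<ge>N. B.H.hnorm (B.emb (y m) - B.emb (y n)) < e" if e: "e > 0" for e
  proof -
    have "0 < e\<^sup>2" using e by simp
    then obtain N where N: "\<And>n m. n \<ge> N \<Longrightarrow> m \<ge> n \<Longrightarrow>
        real n * (A.nrm (y n - y m))\<^sup>2 + (B.nrm (y n - y m))\<^sup>2 < e\<^sup>2"
      using near_minimizers_Cauchy[of real x y "e\<^sup>2"] y by (auto simp: mono_def)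
    have *: "B.nrm (y n - y m) < e" if "n \<ge> N" "m \<ge> n" for n m
    proof (rule power_less_imp_less_base)
      have "0 \<le> real n * (A.nrm (y n - y m))\<^sup>2" by simp
      with N[OF that] show "(B.nrm (y n - y m))\<^sup>2 < e\<^sup>2" by linarith
    qed (use e in simp)
    have "B.nrm (y m - y n) < e" if "m \<ge> N" "n \<ge> N" for m n
      using *[of n m] *[of m n] that B.nrm_minus[of "y m"] by (cases "n \<le> m") auto
    then show ?thesis by (auto simp flip: B.emb_diff simp: B.hnorm_emb)
  qed
  then obtain \<eta> where \<eta>: "\<eta> \<in> hcarrier HB" "(\<lambda>n. B.H.hnorm (B.emb (y n) - \<eta>)) \<longlonglongrightarrow> 0"
    using B.H.Cauchy_hnorm_convergent[of "\<lambda>n. B.emb (y n)"] by auto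
  have "(\<lambda>n. (A.nrm (x - y n))\<^sup>2) \<longlonglongrightarrow> 0"
  proof (rule Lim_null_comparison)
    \<comment> \<open>The penalty is part of an energy that stays below
      \<open>(B.nrm x)\<^sup>2 + 1\<close>, where 1 bounds the slack \<open>inverse (Suc n)\<close>;
      dividing by the weight \<open>n\<close> gives the rate.\<close>
    have "(A.nrm (x - y n))\<^sup>2 \<le> ((B.nrm x)\<^sup>2 + 1) * inverse (real n)" if "n > 0" for n
    proof -
      have "real n * (A.nrm (x - y n))\<^sup>2 \<le> energy (real n) x (y n)" by (simp add: energy_def)
      also have "\<dots> \<le> (B.nrm x)\<^sup>2 + 1"
        using y[of n] min_energy_le_nrm[of "real n" x] le_imp_inverse_le[of 1 "real (Suc n)"]
        by simp
      finally show ?thesis using that by (simp add: field_simps)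
    qed
    then show "\<forall>\<^sub>F n in sequentially. norm ((A.nrm (x - y n))\<^sup>2) \<le> ((B.nrm x)\<^sup>2 + 1) * inverse (real n)"
      by (intro eventually_mono[OF eventually_gt_at_top[of 0]]) simp
    show "(\<lambda>n. ((B.nrm x)\<^sup>2 + 1) * inverse (real n)) \<longlonglongrightarrow> 0"
      using tendsto_mult_left[OF lim_inverse_n, of "(B.nrm x)\<^sup>2 + 1"] by simp
  qed
  then have A0: "(\<lambda>n. A.nrm (x - y n)) \<longlonglongrightarrow> 0"
    using tendsto_real_sqrt by fastforce
  define \<xi> where "\<xi> = B.emb x - \<eta>"
  have "B.H.hnorm (B.emb (x - y n) - \<xi>) = B.H.hnorm (B.emb (y n) - \<eta>)" for n
    using \<eta>(1) B.H.hnorm_commute[of \<eta>] by (simp add: \<xi>_def B.emb_diff)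
  then have \<xi>: "\<xi> \<in> M"
    using A0 \<eta> unfolding multivalued_part_iff
    by (auto intro!: exI[of _ "\<lambda>n. x - y n"] simp: \<xi>_def)
  have "incseq ?\<phi>" by (auto simp: incseq_def intro: min_energy_mono)
  moreover have "\<forall>n. ?\<phi> n \<le> (B.nrm x)\<^sup>2" by (simp add: min_energy_le_nrm)
  ultimately obtain L where L: "?\<phi> \<longlonglongrightarrow> L" by (rule incseq_convergent)
  \<comment> \<open>\<open>L\<close> is now trapped. Each \<open>m\<close> in \<open>M\<close>
    bounds it from above, while dropping the penalty in the energy of \<open>y n\<close> bounds it
    from below by the squared norm of \<eta>, which is \<open>B.emb x - \<xi>\<close>. So \<xi> is
    closest and its squared distance is \<open>L\<close>.\<close>
  have below: "L \<le> (B.H.hnorm (B.emb x - m))\<^sup>2" if "m \<in> M" for m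
    by (rule LIMSEQ_le_const2[OF L]) (simp add: min_energy_le_multivalued that)
  have "(\<lambda>n. (B.nrm (y n))\<^sup>2) \<longlonglongrightarrow> (B.H.hnorm \<eta>)\<^sup>2"
    using B.H.tendsto_hnorm[OF _ \<eta>] by (intro tendsto_intros) (simp add: B.hnorm_emb)
  moreover have "(B.nrm (y n))\<^sup>2 \<le> ?\<phi> n + inverse (Suc n)" for n
  proof -
    have "0 \<le> real n * (A.nrm (x - y n))\<^sup>2" by simp
    with y[of n] show ?thesis unfolding energy_def by linarith
  qed
  ultimately have "(B.H.hnorm \<eta>)\<^sup>2 \<le> L + 0"
    by (intro LIMSEQ_le[OF _ tendsto_add[OF L LIMSEQ_inverse_real_of_nat]]) auto
  then have above: "(B.H.hnorm (B.emb x - \<xi>))\<^sup>2 \<le> L" by (simp add: \<xi>_def)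
  show ?thesis
  proof
    show "B.H.hnorm (B.emb x - \<xi>) \<le> B.H.hnorm (B.emb x - m)" if "m \<in> M" for m
      using order_trans[OF above below[OF that]] that multivalued_part_subset
      by (intro power2_le_imp_le[of "B.H.hnorm (B.emb x - \<xi>)"]) auto
    show "?\<phi> \<longlonglongrightarrow> (B.H.hnorm (B.emb x - \<xi>))\<^sup>2"
      using L below[OF \<xi>] above by (metis order_antisym)
  qed (rule \<xi>)
qed

section \<open>The projection onto \<open>M\<close>, evaluated at vectors
  \<open>emb x\<close>\<close>

abbreviation "P \<equiv> orth_proj HB M"

text \<open>The closest point found in \<open>min_energy_limit\<close> has a residual orthogonal to
  \<open>M\<close> and is therefore the value of \<open>P\<close>; the three facts are this
  identification read in three ways.\<close>

lemma orth_proj_mem: "P (B.emb x) \<in> M"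
  and orth_proj_orthogonal: "m \<in> M \<Longrightarrow> hinner HB (B.emb x - P (B.emb x)) m = 0"
  and min_energy_tendsto:
    "(\<lambda>n. min_energy (real n) x) \<longlonglongrightarrow> (B.H.hnorm (B.emb x - P (B.emb x)))\<^sup>2"
proof -
  obtain \<xi> where \<xi>: "\<xi> \<in> M" "\<And>m. m \<in> M \<Longrightarrow> B.H.hnorm (B.emb x - \<xi>) \<le> B.H.hnorm (B.emb x - m)"
    "(\<lambda>n. min_energy (real n) x) \<longlonglongrightarrow> (B.H.hnorm (B.emb x - \<xi>))\<^sup>2"
    using min_energy_limit[of x] by blast
  note orth = B.H.minimizer_orthogonal[OF multivalued_part_subspace multivalued_part_subset B.emb_mem \<xi>(1,2)]
  have P: "P (B.emb x) = \<xi>"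
    by (rule B.H.orth_proj_eqI[OF multivalued_part_subspace multivalued_part_subset B.emb_mem \<xi>(1) orth])
  show "P (B.emb x) \<in> M" "m \<in> M \<Longrightarrow> hinner HB (B.emb x - P (B.emb x)) m = 0"
    "(\<lambda>n. min_energy (real n) x) \<longlonglongrightarrow> (B.H.hnorm (B.emb x - P (B.emb x)))\<^sup>2"
    unfolding P using \<xi> orth by auto
qed

lemma orth_proj_mem_hcarrier [simp]: "P (B.emb x) \<in> hcarrier HB"
  using orth_proj_mem multivalued_part_subset by blast

lemma orth_proj_add: "P (B.emb (x + y)) = P (B.emb x) + P (B.emb y)"
proof (rule B.H.orth_proj_eqI[OF multivalued_part_subspace multivalued_part_subset B.emb_mem])
  show "P (B.emb x) + P (B.emb y) \<in> M"
    using multivalued_part_subspace orth_proj_mem by (intro B.H.subspace_add)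
  fix m assume m: "m \<in> M"
  have "B.emb (x + y) - (P (B.emb x) + P (B.emb y)) = (B.emb x - P (B.emb x)) + (B.emb y - P (B.emb y))"
    by (simp add: B.emb_add)
  then show "hinner HB (B.emb (x + y) - (P (B.emb x) + P (B.emb y))) m = 0"
    using orth_proj_orthogonal[OF m] m multivalued_part_subset
    by (simp only: B.H.hinner_add_left B.H.hcarrier_closed B.emb_mem orth_proj_mem_hcarrier subsetD)
      simp
qed

lemma orth_proj_scale: "P (B.emb (scaleE c x)) = hscale HB c (P (B.emb x))"
proof (rule B.H.orth_proj_eqI[OF multivalued_part_subspace multivalued_part_subset B.emb_mem])
  show "hscale HB c (P (B.emb x)) \<in> M"
    using multivalued_part_subspace orth_proj_mem by (intro B.H.subspace_scale)
  fix m assume m: "m \<in> M"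
  have "B.emb (scaleE c x) - hscale HB c (P (B.emb x)) = hscale HB c (B.emb x - P (B.emb x))"
    by (simp add: B.emb_scale B.H.scale_right_diff_distrib)
  then show "hinner HB (B.emb (scaleE c x) - hscale HB c (P (B.emb x))) m = 0"
    using orth_proj_orthogonal[OF m] m multivalued_part_subset
    by (simp only: B.H.hinner_scale_left B.H.hcarrier_closed B.emb_mem orth_proj_mem_hcarrier subsetD)
      simp
qed

section \<open>The absolutely continuous part and its quadratic form\<close>

abbreviation "B\<^sub>a \<equiv> abs_cont_part scaleF pair A HA \<iota>A B HB \<iota>B"

lemma pair_abs_cont_part: "pair (B\<^sub>a x) y = hinner HB (B.emb x - P (B.emb x)) (B.emb y)"
  by (simp add: abs_cont_part_def Let_def B.adjoint_J_op B.pair_J_op)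

text \<open>\<open>P (B.emb x)\<close> lies in \<open>M\<close> and the residual is orthogonal to
  \<open>M\<close>, so the second argument \<open>B.emb x\<close> can be replaced by the residual
  itself.\<close>

lemma abs_cont_part_quadratic: "pair (B\<^sub>a x) x = of_real ((B.H.hnorm (B.emb x - P (B.emb x)))\<^sup>2)"
proof -
  have "pair (B\<^sub>a x) x = hinner HB (B.emb x - P (B.emb x)) (B.emb x - P (B.emb x))"
    unfolding pair_abs_cont_part
    using orth_proj_orthogonal[OF orth_proj_mem[of x], of x]
      B.H.hinner_diff_right[of "B.emb x" "P (B.emb x)" "B.emb x - P (B.emb x)"] by simp
  then show ?thesis by (simp add: B.H.hinner_self del: of_real_power)
qed

lemma abs_cont_part_positive: "positive_op scaleE scaleF pair B\<^sub>a"
proof -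
  let ?r = "\<lambda>x. B.emb x - P (B.emb x)"
  have "?r (x + y) = ?r x + ?r y" for x y
    by (simp only: orth_proj_add) (simp add: B.emb_add)
  then have "B\<^sub>a (x + y) = B\<^sub>a x + B\<^sub>a y" for x y
    by (intro A.F_eqI) (simp add: pair_abs_cont_part A.pair_add_left B.H.hinner_add_left)
  moreover have "?r (scaleE c x) = hscale HB c (?r x)" for c x
    by (simp add: orth_proj_scale) (simp add: B.emb_scale B.H.scale_right_diff_distrib)
  then have "B\<^sub>a (scaleE c x) = scaleF c (B\<^sub>a x)" for c x
    by (intro A.F_eqI) (simp add: pair_abs_cont_part A.pair_scale_left B.H.hinner_scale_left)
  ultimately have "Vector_Spaces.linear scaleE scaleF B\<^sub>a"
    using A.E.vector_space_axioms A.F.vector_space_axioms by (simp add: Vector_Spaces.linear_iff)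
  then show ?thesis
    by (simp add: positive_op_def abs_cont_part_quadratic del: of_real_power)
qed

text \<open>The energy of weight 1 for \<open>op_multiple scaleF n A\<close> is the energy of weight
  \<open>n\<close> for \<open>A\<close>. This moves all the parallel sums into the single family
  \<open>min_energy\<close>, whose limit is known.\<close>

lemma parallel_sum_multiple:
  fixes n :: nat
  defines "C \<equiv> parallel_sum scaleE scaleF pair (op_multiple scaleF n A) B"
  shows "positive_op scaleE scaleF pair C" "pair (C x) x = of_real (min_energy (real n) x)"
proof -
  interpret N: two_positive_operators scaleE scaleF pair "op_multiple scaleF n A" B
    by unfold_locales (use A.seq_complete A.op_multiple_positive in auto)
  have "N.energy 1 x y = energy (real n) x y" for y
    unfolding N.energy_def energy_def N.A.nrm_power2 A.nrm_power2 N.A.q_def A.q_def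
    by (simp add: op_multiple_def A.pair_scale_left)
  then have "N.min_energy 1 x = min_energy (real n) x"
    by (simp add: N.min_energy_def min_energy_def)
  then show "positive_op scaleE scaleF pair C" "pair (C x) x = of_real (min_energy (real n) x)"
    using N.parallel_sum_positive N.parallel_sum_quadratic[of x] by (simp_all add: C_def)
qed

theorem parallel_sum_tendsto_abs_cont_part:
  "(\<lambda>n. pair (parallel_sum scaleE scaleF pair (op_multiple scaleF n A) B x) y) \<longlonglongrightarrow> pair (B\<^sub>a x) y"
proof -
  interpret B\<^sub>a: positive_operator scaleE scaleF pair B\<^sub>a
    by unfold_locales (use A.seq_complete abs_cont_part_positive in auto)
  show ?thesis
    by (rule B\<^sub>a.positive_op_tendsto)
      (simp_all add: parallel_sum_multiple abs_cont_part_quadratic tendsto_of_real min_energy_tendsto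
        del: of_real_power)
qed

theorem parallel_limit_eq_abs_cont_part: "parallel_limit scaleE scaleF pair A B = B\<^sub>a"
proof -
  interpret B\<^sub>a: positive_operator scaleE scaleF pair B\<^sub>a
    by unfold_locales (use A.seq_complete abs_cont_part_positive in auto)
  show ?thesis
    unfolding parallel_limit_def
  proof (rule the_equality)
    fix T
    assume "T \<in> weak_ops scaleE scaleF pair \<and> positive_op scaleE scaleF pair T \<and>
      (\<forall>x y. (\<lambda>n. pair (parallel_sum scaleE scaleF pair (op_multiple scaleF n A) B x) y)
        \<longlonglongrightarrow> pair (T x) y)"
    then show "T = B\<^sub>a"
      by (intro ext A.F_eqI LIMSEQ_unique[OF _ parallel_sum_tendsto_abs_cont_part]) blast
  qed (use B\<^sub>a.A_weak_op abs_cont_part_positive parallel_sum_tendsto_abs_cont_part in blast)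
qed

end

theorem theorem4p6:
  fixes scaleE :: "complex \<Rightarrow> 'e::ab_group_add \<Rightarrow> 'e"
    and scaleF :: "complex \<Rightarrow> 'f::ab_group_add \<Rightarrow> 'f"
    and pair :: "'f \<Rightarrow> 'e \<Rightarrow> complex"
    and A B :: "'e \<Rightarrow> 'f"
    and HA :: "'h::ab_group_add hilbert" and \<iota>A :: "'f \<Rightarrow> 'h"
    and HB :: "'k::ab_group_add hilbert" and \<iota>B :: "'f \<Rightarrow> 'k"
  assumes "anti_dual_pair scaleE scaleF pair"
    and "weak_star_seq_complete pair"
    and "A \<in> weak_ops scaleE scaleF pair" and "positive_op scaleE scaleF pair A"
    and "B \<in> weak_ops scaleE scaleF pair" and "positive_op scaleE scaleF pair B"
    and "aux_hilbert scaleF pair A HA \<iota>A"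
    and "aux_hilbert scaleF pair B HB \<iota>B"
  shows "(\<forall>x y. (\<lambda>n. pair (parallel_sum scaleE scaleF pair (op_multiple scaleF n A) B x) y)
            \<longlonglongrightarrow> pair (abs_cont_part scaleF pair A HA \<iota>A B HB \<iota>B x) y)
       \<and> parallel_limit scaleE scaleF pair A B = abs_cont_part scaleF pair A HA \<iota>A B HB \<iota>B"
proof -
  interpret two_aux_spaces scaleE scaleF pair A B HA \<iota>A HB \<iota>B
    using assms
    by (intro two_aux_spaces.intro two_positive_operators.intro aux_space.intro
        positive_operator.intro positive_operator_axioms.intro aux_space_axioms.intro)
  show ?thesis
    using parallel_sum_tendsto_abs_cont_part parallel_limit_eq_abs_cont_part by blast
qed

end
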